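(* Let $\Omega\subset\mathbb{P}(\mathbb{R}^{d+1})$ be a properly convex domain and let $\gamma\in\mathrm{Aut}(\Omega)$ be a rank one isometry with attracting fixed point $\gamma^+$ and repelling fixed point $\gamma^-$. Then $\gamma$ has north-south dynamics on $\partial\Omega$, that is, as $n\to\infty$, $$\left(\gamma|_{\overline\Omega\setminus\{\gamma^-\}}\right)^{n}\to\gamma^{+}\quad\text{and}\quad \left(\gamma|_{\overline\Omega\setminus\{\gamma^+\}}\right)^{-n}\to\gamma^{-},$$ and the convergence (to constant maps) is uniform on compact subsets of $\overline\Omega\setminus\{\gamma^-\}$ and of $\overline\Omega\setminus\{\gamma^+\}$, respectively.
   Context: A properly convex domain is a nonempty open set $\Omega\subset\mathbb{P}(\mathbb{R}^{d+1})$ such that some affine chart contains $\overline\Omega$ and in it $\Omega$ is a bounded convex set. For $x,y\in\overline\Omega$, $[x,y]\subset\overline\Omega$ is the closed projective line segment joining them, and $(x,y)=[x,y]\setminus\{x,y\}$. The Hilbert metric is $d_\Omega(x,y)=\frac12\log\frac{|b-x||y-a|}{|b-y||x-a|}$, where $a,b\in\partial\Omega$ are the endpoints of the intersection of $\overline\Omega$ with the projective line through $x\ne y$, ordered $a,x,y,b$ (computed in an affine chart containing $\overline{\Omega}$). $\mathrm{Aut}(\Omega)=\{g\in\mathrm{PGL}_{d+1}(\mathbb{R}): g\Omega=\Omega\}$. Rank one isometry: $\gamma\in\mathrm{Aut}(\Omega)$ is a rank one isometry if (a) $\tau_\Omega(\gamma):=\inf_{x\in\Omega}d_\Omega(x,\gamma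 x)>0$; (b) $\gamma$ has an axis, i.e. a non-trivial (open) projective line segment of the form $\mathbb{P}(V)\cap\Omega$ with $V\le\mathbb{R}^{d+1}$ a two-dimensional $\gamma$-invariant linear subspace; (c) no axis $(a,b)$ of $\gamma$ ($a,b\in\partial\Omega$) is contained in a half triangle in $\Omega$, i.e. there is no $z\in\partial\Omega$ with $[a,z]\cup[z,b]\subset\partial\Omega$. A rank one isometry $\gamma$ is biproximal (any lift has a unique eigenvalue of maximal modulus and a unique eigenvalue of minimal modulus, each of multiplicity one); $\gamma^+$ (resp. $\gamma^-$) $\in\partial\Omega$ denotes the eigenline of the eigenvalue of maximal (resp. minimal) modulus, and the axis of $\gamma$ is $(\gamma^+,\gamma^-)$. *)

theory Defs
  imports "HOL-Analysis.Analysis" "HOL-Computational_Algebra.Polynomial"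
begin

text \<open>
  A point of \<open>P(R^(d+1))\<close> is a line through the origin of \<open>real ^ 'n\<close>, with \<open>CARD('n) = d + 1\<close>.
\<close>

typedef (overloaded) 'n proj = "{L :: (real ^ 'n::finite) set. subspace L \<and> dim L = 1}"
  morphisms line Abs_proj
proof -
  have "dim (span {axis undefined 1 :: real ^ 'n}) = 1"
    by (simp add: dim_span dim_insert axis_eq_0_iff)
  then show ?thesis by (auto intro!: exI[of _ "span {axis undefined 1 :: real ^ 'n}"])
qed

definition proj_point :: "real ^ 'n \<Rightarrow> 'n::finite proj" where
  "proj_point v = Abs_proj (span {v})"

definition proj_space :: "(real ^ 'n) set \<Rightarrow> 'n::finite proj set" where
  "proj_space V = {p. line p \<subseteq> V}"

definition proj_line :: "'n::finite proj \<Rightarrow> 'n proj \<Rightarrow> 'n proj set" where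
  "proj_line x y = proj_space (span (line x \<union> line y))"

lemma line_eq_span:
  fixes p :: "'n::finite proj"
  assumes "v \<in> line p" "v \<noteq> 0"
  shows "line p = span {v}"
proof -
  have L: "subspace (line p)" "dim (line p) = 1" using line[of p] by auto
  have "span {v} \<subseteq> line p" using L(1) assms(1) by (simp add: span_minimal)
  moreover have "dim (line p) \<le> dim (span {v})"
    using assms(2) L(2) by (simp add: dim_span dim_insert)
  ultimately show ?thesis
    using L(1) subspace_dim_equal[of "span {v}" "line p"] by simp
qed

lemma line_proj_point:
  fixes v :: "real ^ 'n::finite"
  assumes "v \<noteq> 0"
  shows "line (proj_point v) = span {v}"
  unfolding proj_point_def using assms
  by (subst Abs_proj_inverse) (auto simp: dim_insert)

lemma proj_point_line:
  fixes p :: "'n::finite proj"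
  assumes "v \<in> line p" "v \<noteq> 0"
  shows "proj_point v = p"
  using line_eq_span[OF assms] line_proj_point[OF assms(2)] line_inject by metis

definition unit_rep :: "'n::finite proj \<Rightarrow> real ^ 'n" where
  "unit_rep p = (SOME u. u \<in> line p \<and> norm u = 1)"

lemma unit_rep:
  fixes p :: "'n::finite proj"
  shows "unit_rep p \<in> line p" "norm (unit_rep p) = 1"
proof -
  have L: "subspace (line p)" "dim (line p) = 1" using line[of p] by auto
  have "\<not> line p \<subseteq> {0}" using L(2) by (metis dim_eq_0 zero_neq_one)
  then obtain v where v: "v \<in> line p" "v \<noteq> 0" by blast
  have "(1 / norm v) *\<^sub>R v \<in> line p \<and> norm ((1 / norm v) *\<^sub>R v) = 1"
    using v L(1) by (simp add: subspace_scale)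
  then have "unit_rep p \<in> line p \<and> norm (unit_rep p) = 1"
    unfolding unit_rep_def by (rule someI)
  then show "unit_rep p \<in> line p" "norm (unit_rep p) = 1" by auto
qed

lemma unit_in_line:
  fixes p :: "'n::finite proj"
  assumes "u \<in> line p" "norm u = 1"
  shows "u = unit_rep p \<or> u = - unit_rep p"
proof -
  have "unit_rep p \<noteq> 0" using unit_rep(2)[of p] by auto
  then have "line p = span {unit_rep p}" using line_eq_span unit_rep(1) by blast
  then obtain c where c: "u = c *\<^sub>R unit_rep p" using assms(1) by (auto simp: span_singleton)
  then have "\<bar>c\<bar> = 1" using assms(2) unit_rep(2)[of p] by simp
  then show ?thesis using c by (auto simp: abs_if split: if_splits)
qed

text \<open>
  The distance between two lines is the distance between the corresponding pairs of antipodal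
  points of the unit sphere. The lemma \<open>open_proj_iff\<close> below shows that it induces the quotient
  topology; as projective space is compact, uniform convergence does not depend on the choice of
  a compatible metric.
\<close>

instantiation proj :: (finite) metric_space
begin

definition dist_proj :: "'a proj \<Rightarrow> 'a proj \<Rightarrow> real" where
  "dist_proj p q = min (norm (unit_rep p - unit_rep q)) (norm (unit_rep p + unit_rep q))"

definition uniformity_proj :: "('a proj \<times> 'a proj) filter" where
  "uniformity_proj = (INF e\<in>{0 <..}. principal {(x, y). dist x y < e})"

definition open_proj :: "'a proj set \<Rightarrow> bool" where
  "open_proj U = (\<forall>x\<in>U. eventually (\<lambda>(x', y). x' = x \<longrightarrow> y \<in> U) uniformity)"

instance
proof
  fix p q r :: "'a proj"
  show "dist p q = 0 \<longleftrightarrow> p = q"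
  proof
    assume "dist p q = 0"
    then have "unit_rep p = unit_rep q \<or> unit_rep p = - unit_rep q"
      unfolding dist_proj_def min_def by (auto simp: add_eq_0_iff split: if_splits)
    then have "unit_rep q \<in> line p"
      using unit_rep(1)[of p] line[of p] subspace_neg[of "line p" "unit_rep p"] by auto
    moreover have "unit_rep q \<noteq> 0" using unit_rep(2)[of q] by auto
    ultimately show "p = q" using unit_rep(1)[of q] proj_point_line by blast
  qed (simp add: dist_proj_def)
  have 1: "norm (unit_rep p - unit_rep q) \<le> norm (unit_rep p - unit_rep r) + norm (unit_rep q - unit_rep r)"
    by (metis norm_minus_commute norm_diff_triangle_le order_refl)
  have 2: "norm (unit_rep p - unit_rep q) \<le> norm (unit_rep p + unit_rep r) + norm (unit_rep q + unit_rep r)"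
    using norm_triangle_ineq4[of "unit_rep p + unit_rep r" "unit_rep q + unit_rep r"] by simp
  have 3: "norm (unit_rep p + unit_rep q) \<le> norm (unit_rep p - unit_rep r) + norm (unit_rep q + unit_rep r)"
    using norm_triangle_ineq[of "unit_rep p - unit_rep r" "unit_rep q + unit_rep r"] by (simp add: algebra_simps)
  have 4: "norm (unit_rep p + unit_rep q) \<le> norm (unit_rep p + unit_rep r) + norm (unit_rep q - unit_rep r)"
    using norm_triangle_ineq[of "unit_rep p + unit_rep r" "unit_rep q - unit_rep r"] by (simp add: algebra_simps)
  show "dist p q \<le> dist p r + dist q r"
    unfolding dist_proj_def using 1 2 3 4 by linarith
qed (simp_all add: uniformity_proj_def open_proj_def)

end

lemma dist_proj_point_le:
  fixes u v :: "real ^ 'n::finite"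
  assumes "norm u = 1" "norm v = 1"
  shows "dist (proj_point u) (proj_point v) \<le> dist u v"
proof -
  have nz: "u \<noteq> 0" "v \<noteq> 0" using assms by auto
  have "u \<in> line (proj_point u)" "v \<in> line (proj_point v)"
    unfolding line_proj_point[OF nz(1)] line_proj_point[OF nz(2)] by (simp_all add: span_base)
  then have "u = unit_rep (proj_point u) \<or> u = - unit_rep (proj_point u)"
    "v = unit_rep (proj_point v) \<or> v = - unit_rep (proj_point v)"
    using unit_in_line assms by blast+
  moreover have "norm (u - v) = norm (u' - v') \<or> norm (u - v) = norm (u' + v')"
    if "u = u' \<or> u = - u'" "v = v' \<or> v = - v'" for u' v' :: "real ^ 'n"
    using that norm_minus_cancel[of "u' + v'"] norm_minus_commute[of u' v'] by auto
  ultimately have "norm (u - v) = norm (unit_rep (proj_point u) - unit_rep (proj_point v)) \<or>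
    norm (u - v) = norm (unit_rep (proj_point u) + unit_rep (proj_point v))"
    by blast
  then show ?thesis unfolding dist_proj_def dist_norm by auto
qed

lemma open_proj_iff:
  fixes U :: "'n::finite proj set"
  shows "open U \<longleftrightarrow> open {v. v \<noteq> 0 \<and> proj_point v \<in> U}"
proof
  have sc: "proj_point (sgn v) = proj_point v" if "v \<noteq> 0" for v :: "real ^ 'n"
    using that line_proj_point[OF that]
    by (intro proj_point_line) (auto simp: sgn_div_norm span_base span_scale sgn_zero_iff)
  assume U: "open U"
  have "continuous_on (- {0}) (proj_point :: real ^ 'n \<Rightarrow> _)"
    unfolding continuous_on_iff
  proof safe
    fix x :: "real ^ 'n" and e :: real assume x: "x \<noteq> 0" and e: "0 < e"
    have "isCont sgn x" using x by (intro isCont_sgn) auto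
    then obtain d where d: "d > 0" "\<And>y. dist y x < d \<Longrightarrow> dist (sgn y) (sgn x) < e"
      using e unfolding continuous_at_eps_delta by metis
    have "dist (proj_point y) (proj_point x) < e" if "y \<noteq> 0" "dist y x < d" for y
      using dist_proj_point_le[of "sgn y" "sgn x"] d(2)[OF that(2)] that x
      by (simp add: sc norm_sgn)
    then show "\<exists>d>0. \<forall>y\<in>- {0}. dist y x < d \<longrightarrow> dist (proj_point y) (proj_point x) < e"
      using d(1) by auto
  qed
  then have "open (proj_point -` U \<inter> - {0 :: real ^ 'n})"
    using U continuous_on_open_vimage[of "- {0 :: real ^ 'n}" proj_point] by auto
  moreover have "proj_point -` U \<inter> - {0} = {v. v \<noteq> 0 \<and> proj_point v \<in> U}" by auto
  ultimately show "open {v. v \<noteq> 0 \<and> proj_point v \<in> U}" by simp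
next
  assume *: "open {v. v \<noteq> 0 \<and> proj_point v \<in> U}"
  show "open U" unfolding open_dist
  proof
    fix p assume p: "p \<in> U"
    have n0: "unit_rep q \<noteq> 0" for q :: "'n proj" using unit_rep(2)[of q] by auto
    have "unit_rep p \<in> {v. v \<noteq> 0 \<and> proj_point v \<in> U}"
      using p n0 proj_point_line[OF unit_rep(1) n0] by simp
    then obtain e where e: "e > 0" "\<And>v. dist v (unit_rep p) < e \<Longrightarrow> v \<noteq> 0 \<and> proj_point v \<in> U"
      using * unfolding open_dist by blast
    have "q \<in> U" if "dist q p < e" for q
    proof -
      have "norm (- unit_rep q - unit_rep p) = norm (unit_rep q + unit_rep p)"
        using norm_minus_cancel[of "unit_rep q + unit_rep p"] by simp
      then have "dist (unit_rep q) (unit_rep p) < e \<or> dist (- unit_rep q) (unit_rep p) < e"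
        using that unfolding dist_proj_def dist_norm min_less_iff_disj by metis
      then show ?thesis
      proof
        assume "dist (unit_rep q) (unit_rep p) < e"
        then show ?thesis using e(2) proj_point_line[OF unit_rep(1) n0] by metis
      next
        assume a: "dist (- unit_rep q) (unit_rep p) < e"
        have "- unit_rep q \<in> line q" using unit_rep(1)[of q] line[of q] by (simp add: subspace_neg)
        then have "proj_point (- unit_rep q) = q" using n0 proj_point_line by fastforce
        then show ?thesis using e(2)[OF a] by simp
      qed
    qed
    then show "\<exists>e>0. \<forall>q. dist q p < e \<longrightarrow> q \<in> U" using e(1) by blast
  qed
qed

definition proj_map :: "real ^ 'n ^ 'n \<Rightarrow> 'n::finite proj \<Rightarrow> 'n proj" where
  "proj_map A p = Abs_proj ((\<lambda>v. A *v v) ` line p)"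

definition lift_of :: "real ^ 'n ^ 'n \<Rightarrow> ('n::finite proj \<Rightarrow> 'n proj) \<Rightarrow> bool" where
  "lift_of A g \<longleftrightarrow> invertible A \<and> g = proj_map A"

text \<open>
  The group \<open>PGL\<close> acts faithfully on projective space; its elements are identified with the
  transformations they induce.
\<close>

definition PGL :: "('n::finite proj \<Rightarrow> 'n proj) set" where
  "PGL = {g. \<exists>A. lift_of A g}"

definition Aut :: "'n::finite proj set \<Rightarrow> ('n proj \<Rightarrow> 'n proj) set" where
  "Aut \<Omega> = {g \<in> PGL. g ` \<Omega> = \<Omega>}"

text \<open>
  A nonzero vector \<open>w\<close> gives the affine chart consisting of the lines not contained in the
  hyperplane \<open>w\<^sup>\<bottom>\<close>; it is identified with the affine hyperplane \<open>{x. w \<bullet> x = 1}\<close> by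
  intersecting lines with it.
\<close>

definition chart :: "real ^ 'n \<Rightarrow> 'n::finite proj set" where
  "chart w = {p. \<exists>x\<in>line p. w \<bullet> x = 1}"

definition coord :: "real ^ 'n \<Rightarrow> 'n::finite proj \<Rightarrow> real ^ 'n" where
  "coord w p = (THE x. x \<in> line p \<and> w \<bullet> x = 1)"

definition convex_chart :: "'n::finite proj set \<Rightarrow> real ^ 'n \<Rightarrow> bool" where
  "convex_chart \<Omega> w \<longleftrightarrow>
    w \<noteq> 0 \<and> closure \<Omega> \<subseteq> chart w \<and> bounded (coord w ` \<Omega>) \<and> convex (coord w ` \<Omega>)"

definition properly_convex :: "'n::finite proj set \<Rightarrow> bool" where
  "properly_convex \<Omega> \<longleftrightarrow> \<Omega> \<noteq> {} \<and> open \<Omega> \<and> (\<exists>w. convex_chart \<Omega> w)"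

text \<open>
  Segments and the Hilbert metric are computed in one chosen chart. The result is the same in every
  chart containing the closure of \<open>\<Omega>\<close>: projective changes of charts preserve lines and
  cross-ratios, and the segment joining two points of the closure of \<open>\<Omega>\<close> inside that closure is
  unique.
\<close>

definition aff :: "'n::finite proj set \<Rightarrow> 'n proj \<Rightarrow> real ^ 'n" where
  "aff \<Omega> = coord (SOME w. convex_chart \<Omega> w)"

definition seg :: "'n::finite proj set \<Rightarrow> 'n proj \<Rightarrow> 'n proj \<Rightarrow> 'n proj set" where
  "seg \<Omega> x y = {p \<in> closure \<Omega>. aff \<Omega> p \<in> closed_segment (aff \<Omega> x) (aff \<Omega> y)}"

definition open_seg :: "'n::finite proj set \<Rightarrow> 'n proj \<Rightarrow> 'n proj \<Rightarrow> 'n proj set" where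
  "open_seg \<Omega> x y = seg \<Omega> x y - {x, y}"

text \<open>
  For distinct points \<open>x\<close> and \<open>y\<close>, the conditions on the two memberships in segments say that
  \<open>a\<close>, \<open>x\<close>, \<open>y\<close>, \<open>b\<close> lie in this order.
\<close>

definition chord_ends ::
  "'n::finite proj set \<Rightarrow> 'n proj \<Rightarrow> 'n proj \<Rightarrow> 'n proj \<Rightarrow> 'n proj \<Rightarrow> bool" where
  "chord_ends \<Omega> x y a b \<longleftrightarrow>
    a \<in> frontier \<Omega> \<and> b \<in> frontier \<Omega> \<and> closure \<Omega> \<inter> proj_line x y = seg \<Omega> a b \<and>
    x \<in> seg \<Omega> a y \<and> y \<in> seg \<Omega> x b"

definition hilbert_dist :: "'n::finite proj set \<Rightarrow> 'n proj \<Rightarrow> 'n proj \<Rightarrow> real" where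
  "hilbert_dist \<Omega> x y =
    (if x = y then 0 else
      THE r. \<exists>a b. chord_ends \<Omega> x y a b \<and>
        r = 1 / 2 * ln ((dist (aff \<Omega> b) (aff \<Omega> x) * dist (aff \<Omega> y) (aff \<Omega> a)) /
                        (dist (aff \<Omega> b) (aff \<Omega> y) * dist (aff \<Omega> x) (aff \<Omega> a))))"

definition translation_length :: "'n::finite proj set \<Rightarrow> ('n proj \<Rightarrow> 'n proj) \<Rightarrow> real" where
  "translation_length \<Omega> g = (INF x\<in>\<Omega>. hilbert_dist \<Omega> x (g x))"

text \<open>\<open>axis_ends \<Omega> g a b\<close> says that the open segment \<open>(a, b)\<close> is an axis of \<open>g\<close>.\<close>

definition axis_ends ::
  "'n::finite proj set \<Rightarrow> ('n proj \<Rightarrow> 'n proj) \<Rightarrow> 'n proj \<Rightarrow> 'n proj \<Rightarrow> bool" where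
  "axis_ends \<Omega> g a b \<longleftrightarrow>
    a \<in> frontier \<Omega> \<and> b \<in> frontier \<Omega> \<and> a \<noteq> b \<and>
    (\<exists>V. subspace V \<and> dim V = 2 \<and> g ` proj_space V \<subseteq> proj_space V \<and>
      proj_space V \<inter> \<Omega> = open_seg \<Omega> a b)"

definition in_half_triangle :: "'n::finite proj set \<Rightarrow> 'n proj \<Rightarrow> 'n proj \<Rightarrow> bool" where
  "in_half_triangle \<Omega> a b \<longleftrightarrow> (\<exists>z\<in>frontier \<Omega>. seg \<Omega> a z \<union> seg \<Omega> z b \<subseteq> frontier \<Omega>)"

definition rank_one_isometry :: "'n::finite proj set \<Rightarrow> ('n proj \<Rightarrow> 'n proj) \<Rightarrow> bool" where
  "rank_one_isometry \<Omega> g \<longleftrightarrow>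
    g \<in> Aut \<Omega> \<and>
    translation_length \<Omega> g > 0 \<and>
    (\<exists>a b. axis_ends \<Omega> g a b) \<and>
    (\<forall>a b. axis_ends \<Omega> g a b \<longrightarrow> \<not> in_half_triangle \<Omega> a b)"

definition complexify :: "real ^ 'n ^ 'n \<Rightarrow> complex ^ 'n ^ 'n" where
  "complexify A = (\<chi> i j. complex_of_real (A $ i $ j))"

definition eigenvalue :: "real ^ 'n ^ 'n \<Rightarrow> complex \<Rightarrow> bool" where
  "eigenvalue A l \<longleftrightarrow> (\<exists>v. v \<noteq> 0 \<and> complexify A *v v = l *s v)"

definition char_poly :: "real ^ 'n ^ 'n \<Rightarrow> complex poly" where
  "char_poly A = det (\<chi> i j. (if i = j then [:0, 1:] else 0) - [:complexify A $ i $ j:])"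

definition max_eigenvalue :: "real ^ 'n ^ 'n \<Rightarrow> complex \<Rightarrow> bool" where
  "max_eigenvalue A l \<longleftrightarrow> eigenvalue A l \<and> order l (char_poly A) = 1 \<and>
    (\<forall>m. eigenvalue A m \<and> m \<noteq> l \<longrightarrow> cmod m < cmod l)"

definition min_eigenvalue :: "real ^ 'n ^ 'n \<Rightarrow> complex \<Rightarrow> bool" where
  "min_eigenvalue A l \<longleftrightarrow> eigenvalue A l \<and> order l (char_poly A) = 1 \<and>
    (\<forall>m. eigenvalue A m \<and> m \<noteq> l \<longrightarrow> cmod l < cmod m)"

text \<open>
  The eigenvalues of a real matrix are closed under conjugation, so a unique eigenvalue of maximal
  or minimal modulus is real. Lifts differ by nonzero real scalars, hence the eigenlines below do
  not depend on the lift.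
\<close>

definition attracting_point :: "('n::finite proj \<Rightarrow> 'n proj) \<Rightarrow> 'n proj" where
  "attracting_point g =
    (THE p. \<exists>A r. lift_of A g \<and> max_eigenvalue A (complex_of_real r) \<and>
      line p = {v. A *v v = r *\<^sub>R v})"

definition repelling_point :: "('n::finite proj \<Rightarrow> 'n proj) \<Rightarrow> 'n proj" where
  "repelling_point g =
    (THE p. \<exists>A r. lift_of A g \<and> min_eigenvalue A (complex_of_real r) \<and>
      line p = {v. A *v v = r *\<^sub>R v})"

end

theory Submission imports Defs begin

text \<open>
  Work in the open convex cone over \<open>\<Omega>\<close>, with closure \<open>K\<close>, and let \<open>A\<close> be a lift of the isometry
  preserving it, with eigenvectors \<open>a\<close>, \<open>b\<close> of eigenvalues \<open>\<alpha> > \<beta> > 0\<close> spanning the axis. Averaging gives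
  functionals \<open>f\<close>, \<open>g\<close>, nonnegative on \<open>K\<close>, with \<open>f \<circ> A = \<alpha> f\<close> and \<open>g \<circ> A = \<beta> g\<close>, dual to \<open>a\<close>, \<open>b\<close>.
  The absence of half triangles forces \<open>f + g > 0\<close> on \<open>K - {0}\<close> and, by a contraction argument on the
  face \<open>g = 0\<close>, that this face is the ray of \<open>a\<close>. As \<open>g / f\<close> is multiplied by \<open>\<beta> / \<alpha> < 1\<close> under
  \<open>A\<close>, compact subsets of \<open>K\<close> on which \<open>f > 0\<close> are attracted uniformly to the ray of \<open>a\<close>. Applied to
  \<open>a + b + t v\<close> with \<open>f v = 0\<close>, this shows that \<open>A / \<alpha>\<close> contracts the kernel of \<open>f\<close>, so \<open>\<alpha>\<close> is the simple
  eigenvalue of maximal modulus; the same argument for the inverse treats \<open>\<beta>\<close> and \<open>b\<close>.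
\<close>

section \<open>Simple eigenvalues\<close>

text \<open>The axis controls only the plane spanned by \<open>a\<close> and \<open>b\<close>: no
  hypothesis says that \<alpha> dominates the other eigenvalues of \<open>A\<close>. Dominance has
  to come from the geometry of the boundary, so the dynamics on \<open>K\<close> precede every
  spectral statement; the latter is still required because the attracting and repelling points are
  defined through simple eigenvalues of extremal modulus. In the cone, a half triangle is a nonzero
  \<open>z\<close> in \<open>K\<close> with both \<open>z + a\<close> and \<open>z + b\<close>
  outside \<open>C\<close>. Since \<open>f\<close> vanishes at \<open>b\<close>, \<open>g\<close>
  vanishes at \<open>a\<close>, and both are positive on \<open>C\<close>, excluding such
  \<open>z\<close> makes \<open>f + g\<close> positive, and the slice \<open>f + g = 1\<close> of
  \<open>K\<close> becomes a compact model of the closed domain in which rescaled iterates can be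
  compared. Positive translation length excludes a fixed point on the axis, which yields \<alpha>
  \<noteq> \<beta> and keeps the two ends from being swapped.\<close>

text \<open>Conjugating with the matrix obtained from the identity by replacing one column by \<open>a\<close> turns
  the rank one perturbation into one that changes a single row.\<close>

lemma det_rank_one_update:
  fixes a f :: "'a::field ^ 'n::finite"
  assumes "(\<Sum>i\<in>UNIV. f $ i * a $ i) = 1"
  shows "det (mat 1 + (\<chi> i j. c * a $ i * f $ j)) = 1 + c"
proof -
  obtain k where k: "a $ k \<noteq> 0"
  proof -
    have "\<exists>k. a $ k \<noteq> 0"
    proof (rule ccontr)
      assume "\<nexists>k. a $ k \<noteq> 0"
      then show False using assms by simp
    qed
    then show ?thesis using that by blast
  qed
  define N where "N = mat 1 + (\<chi> i j. c * a $ i * f $ j)"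
  define E :: "'a^'n^'n" where "E = (\<chi> i j. if j = k then a $ i else if i = j then 1 else 0)"
  define G :: "'a^'n^'n" where
    "G = (\<chi> i j. if i = k then (if j = k then 1 + c else c * f $ j) else if i = j then 1 else 0)"
  have "E = (\<chi> i j. if j = k then (mat 1 *v a) $ i else mat 1 $ i $ j)"
    by (simp only: matrix_vector_mul_lid) (simp add: E_def mat_def vec_eq_iff)
  then have "det E = a $ k" using cramer_lemma[of k "mat 1 :: 'a^'n^'n" a] by simp
  moreover have "det G = 1 + c"
  proof -
    define x where "x = (\<chi> j. if j = k then 1 + c else c * f $ j)"
    have "G = (\<chi> i. if i = k then (\<Sum>j\<in>UNIV. x $ j *s row j (mat 1)) else row i (mat 1))"
    proof -
      have "(\<Sum>j\<in>UNIV. x $ j *s row j (mat 1)) $ l = x $ l" for l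
      proof -
        have "(\<Sum>j\<in>UNIV. x $ j *s row j (mat 1)) $ l = (\<Sum>j\<in>UNIV. if j = l then x $ l else 0)"
          unfolding sum_component by (rule sum.cong) (auto simp: row_def mat_def)
        then show ?thesis by simp
      qed
      then show ?thesis by (simp add: vec_eq_iff G_def x_def row_def mat_def)
    qed
    then show ?thesis
      using cramer_lemma_transpose[of k x "mat 1 :: 'a^'n^'n"] by (simp add: x_def)
  qed
  \<comment> \<open>As \<open>a\<close> is column \<open>k\<close> of \<open>E\<close>, the
    perturbation pulls back to row \<open>k\<close>: its entries are those of \<open>f\<close>,
    except that the entry \<open>k\<close> becomes the pairing of \<open>f\<close> with
    \<open>a\<close>, which is 1.\<close>
  moreover have "N ** E = E ** G"
  proof -
    have fa: "(\<Sum>j\<in>UNIV. c * a $ i * f $ j * a $ j) = c * a $ i" for i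
      using assms by (simp add: sum_distrib_left[symmetric] mult.assoc)
    have 1: "(N ** E) $ i $ j = (if j = k then (1 + c) * a $ i else (if i = j then 1 else 0) + c * a $ i * f $ j)" for i j
    proof (cases "j = k")
      case True
      have "(N ** E) $ i $ j = (\<Sum>l\<in>UNIV. (if i = l then a $ l else 0) + c * a $ i * f $ l * a $ l)"
        unfolding True N_def E_def matrix_matrix_mult_def
        by (simp, intro sum.cong) (auto simp: mat_def distrib_right)
      then show ?thesis using True by (simp add: sum.distrib fa distrib_right)
    next
      case False
      have "(N ** E) $ i $ j = (\<Sum>l\<in>UNIV. if l = j then (if i = j then 1 else 0) + c * a $ i * f $ j else 0)"
        unfolding matrix_matrix_mult_def vec_lambda_beta using False
        by (intro sum.cong) (auto simp: N_def E_def mat_def)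
      then show ?thesis using False by (simp add: sum.delta)
    qed
    have 2: "(E ** G) $ i $ j = (if j = k then (1 + c) * a $ i else (if i = j then 1 else 0) + c * a $ i * f $ j)" for i j
    proof -
      have "(E ** G) $ i $ j = E $ i $ k * G $ k $ j + (\<Sum>l\<in>UNIV - {k}. E $ i $ l * G $ l $ j)"
        unfolding matrix_matrix_mult_def by (simp add: sum.remove[of UNIV k])
      also have "(\<Sum>l\<in>UNIV - {k}. E $ i $ l * G $ l $ j)
          = (\<Sum>l\<in>UNIV - {k}. if l = i then (if i = j then 1 else 0) else 0)"
        by (rule sum.cong) (auto simp: E_def G_def)
      also have "\<dots> = (if i \<noteq> k \<and> i = j then 1 else 0)"
        by (subst sum.delta) auto
      finally show ?thesis by (auto simp: E_def G_def)
    qed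
    show ?thesis by (simp add: vec_eq_iff 1 2)
  qed
  then have "det N * det E = det E * det G" by (metis det_mul)
  ultimately show ?thesis using k by (simp add: N_def)
qed

lemma poly_det: "poly (det M) x = det (\<chi> i j. poly (M $ i $ j) x)"
  for M :: "'a::comm_ring_1 poly ^ 'n ^ 'n"
  unfolding det_def by (simp add: poly_sum poly_prod)

lemma poly_char_poly: "poly (char_poly A) x = det (mat x - complexify A)"
  unfolding char_poly_def poly_det
  by (intro arg_cong[where f = det]) (auto simp: vec_eq_iff mat_def)

definition complex_vec :: "real ^ 'n \<Rightarrow> complex ^ 'n" where
  "complex_vec v = (\<chi> i. complex_of_real (v $ i))"

lemma complexify_mult: "complexify A *v complex_vec v = complex_vec (A *v v)"
  by (simp add: vec_eq_iff complexify_def complex_vec_def matrix_vector_mult_def)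

text \<open>A real matrix acts separately on real and imaginary parts, so a complex eigenvector can
  be studied through a pair of real vectors.\<close>

lemma complex_vec_parts:
  obtains x y where "v = complex_vec x + \<i> *s complex_vec y"
proof
  show "v = complex_vec (\<chi> i. Re (v $ i)) + \<i> *s complex_vec (\<chi> i. Im (v $ i))"
    by (simp add: vec_eq_iff complex_vec_def complex_eq)
qed

lemma complex_vec_parts_eq_iff:
  "complex_vec x + \<i> *s complex_vec y = complex_vec x' + \<i> *s complex_vec y' \<longleftrightarrow> x = x' \<and> y = y'"
  by (auto simp: vec_eq_iff complex_vec_def complex_eq_iff)

lemma complexify_mult_parts:
  "complexify A *v (complex_vec x + \<i> *s complex_vec y) = complex_vec (A *v x) + \<i> *s complex_vec (A *v y)"
  by (simp add: matrix_vector_right_distrib vector_scalar_commute complexify_mult)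

lemma sum_complex_vec_parts:
  "(\<Sum>j\<in>UNIV. complex_of_real (f $ j) * (complex_vec x + \<i> *s complex_vec y) $ j)
    = complex_of_real (f \<bullet> x) + \<i> * complex_of_real (f \<bullet> y)"
  by (simp add: complex_vec_def inner_vec_def distrib_left sum.distrib sum_distrib_left mult.left_commute)

lemma mat_mult: "mat x *v v = x *s v" for v :: "'a::comm_semiring_1 ^ 'n"
proof -
  have "(mat x *v v) $ i = (\<Sum>j\<in>UNIV. if j = i then x * v $ i else 0)" for i
    unfolding matrix_vector_mult_def vec_lambda_beta by (intro sum.cong) (auto simp: mat_def)
  then show ?thesis by (simp add: vec_eq_iff)
qed

text \<open>The matrix \<open>A' = A - r a f\<^sup>T\<close> satisfies \<open>x det (x - A) = (x - r) det (x - A')\<close>, and \<open>r\<close> is not an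
  eigenvalue of \<open>A'\<close>.\<close>

lemma order_char_poly_eq_1:
  fixes A :: "real ^ 'n::finite ^ 'n" and a f :: "real ^ 'n"
  assumes "A *v a = r *\<^sub>R a" and fA: "\<And>x. f \<bullet> (A *v x) = r * (f \<bullet> x)" and "f \<bullet> a = 1" "r \<noteq> 0"
    and eigenspace: "\<And>v. A *v v = r *\<^sub>R v \<Longrightarrow> v = (f \<bullet> v) *\<^sub>R a"
  shows "order (complex_of_real r) (char_poly A) = 1"
proof -
  define A' :: "real ^ 'n ^ 'n" where "A' = (\<chi> i j. A $ i $ j - r * a $ i * f $ j)"
  have fa: "(\<Sum>i\<in>UNIV. complex_vec f $ i * complex_vec a $ i) = 1"
    using assms(3) by (simp add: complex_vec_def inner_vec_def flip: of_real_mult of_real_sum)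
  have cAa: "(\<Sum>k\<in>UNIV. complex_of_real (A $ i $ k) * complex_of_real (a $ k)) = complex_of_real (r * a $ i)" for i
  proof -
    have "(\<Sum>k\<in>UNIV. A $ i $ k * a $ k) = r * a $ i"
      using assms(1) by (simp add: vec_eq_iff matrix_vector_mult_def)
    then show ?thesis by (simp flip: of_real_mult of_real_sum)
  qed
  have rel: "(x - r) * poly (char_poly A') x = x * poly (char_poly A) x" if "x \<noteq> complex_of_real r" for x
  proof -
    \<comment> \<open>Since \<open>x - A\<close> multiplies \<open>a\<close> by
      \<open>x - r\<close>, this \<open>c\<close> turns \<open>(x - A) N\<close> into
      \<open>x - A'\<close>; moreover \<open>1 + c = x / (x - r)\<close>.\<close>
    define c where "c = complex_of_real r / (x - r)"
    define N where "N = mat 1 + (\<chi> i j. c * complex_vec a $ i * complex_vec f $ j)"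
    have "(mat x - complexify A) ** N = mat x - complexify A'"
    proof -
      have "((mat x - complexify A) ** N) $ i $ j = (mat x - complexify A') $ i $ j" for i j
      proof -
        have "((mat x - complexify A) ** N) $ i $ j
          = (\<Sum>k\<in>UNIV. ((if i = k then x else 0) - A $ i $ k) * ((if k = j then 1 else 0) + c * a $ k * f $ j))"
          by (simp add: matrix_matrix_mult_def N_def mat_def complexify_def complex_vec_def)
        also have "\<dots> = (\<Sum>k\<in>UNIV. (if k = j then (if i = j then x else 0) - A $ i $ j else 0)
            + ((if i = k then x * c * a $ i * f $ j else 0) - (A $ i $ k * a $ k) * (c * f $ j)))"
          by (intro sum.cong) (auto simp: algebra_simps)
        also have "\<dots> = (if i = j then x else 0) - A $ i $ j
            + (x * c * a $ i * f $ j - complex_of_real (r * a $ i) * (c * f $ j))"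
          by (simp only: sum.distrib sum_subtractf sum.delta sum.delta' finite UNIV_I if_True
              sum_distrib_right[symmetric] of_real_mult cAa)
        also have "x * c * a $ i * f $ j - complex_of_real (r * a $ i) * (c * f $ j) = r * a $ i * f $ j"
        proof -
          have "(x - r) * c = complex_of_real r" using that by (simp add: c_def)
          then have "(x - r) * c * (a $ i * f $ j) = r * (a $ i * f $ j)" by simp
          then show ?thesis by (simp add: algebra_simps)
        qed
        finally show ?thesis by (simp add: mat_def complexify_def A'_def)
      qed
      then show ?thesis by (simp add: vec_eq_iff)
    qed
    moreover have "det N = 1 + c" unfolding N_def by (rule det_rank_one_update[OF fa])
    ultimately have "poly (char_poly A') x = poly (char_poly A) x * (1 + c)"
      unfolding poly_char_poly by (metis det_mul)
    then show ?thesis using that by (simp add: c_def field_simps)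
  qed
  let ?l = "[:- complex_of_real r, 1:]"
  \<comment> \<open>The extra factor \<open>?l\<close> makes both sides vanish at \<open>r\<close>,
    where \<open>rel\<close> gives no information; it is cancelled right after.\<close>
  have "?l * (?l * char_poly A') = ?l * ([:0, 1:] * char_poly A)"
  proof (rule poly_eq_poly_eq_iff[THEN iffD1], rule ext)
    fix x show "poly (?l * (?l * char_poly A')) x = poly (?l * ([:0, 1:] * char_poly A)) x"
    proof (cases "x = complex_of_real r")
      case False
      have "poly ?l x = x - r" by simp
      then show ?thesis using rel[OF False] by (simp only: poly_mult) simp
    qed simp
  qed
  then have eq: "?l * char_poly A' = [:0, 1:] * char_poly A"
    by (subst (asm) mult_cancel_left) (simp only: pCons_eq_0_iff one_neq_zero simp_thms)
  have nz: "poly (char_poly A') (complex_of_real r) \<noteq> 0"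
  proof
    assume "poly (char_poly A') (complex_of_real r) = 0"
    then have "\<not> invertible (mat (complex_of_real r) - complexify A')"
      by (simp add: poly_char_poly invertible_det_nz)
    then obtain v where v: "v \<noteq> 0" "(mat (complex_of_real r) - complexify A') *v v = 0"
      by (metis invertible_left_inverse matrix_left_invertible_ker)
    obtain x y where xy: "v = complex_vec x + \<i> *s complex_vec y" using complex_vec_parts by blast
    have "mat (complex_of_real r) *v v = complex_vec (r *\<^sub>R x) + \<i> *s complex_vec (r *\<^sub>R y)"
      unfolding xy mat_mult by (simp add: vec_eq_iff complex_vec_def distrib_left)
    then have "complex_vec (r *\<^sub>R x) + \<i> *s complex_vec (r *\<^sub>R y) = complex_vec (A' *v x) + \<i> *s complex_vec (A' *v y)"
      using v(2) by (simp add: xy matrix_vector_mult_diff_rdistrib complexify_mult_parts)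
    then have "A' *v x = r *\<^sub>R x" "A' *v y = r *\<^sub>R y" unfolding complex_vec_parts_eq_iff by auto
    \<comment> \<open>\<open>f\<close> annihilates the range of \<open>A'\<close>, so an eigenvector
      for \<open>r\<close>, which is nonzero, lies in the kernel of \<open>f\<close>. There
      \<open>A'\<close> agrees with \<open>A\<close>.\<close>
    moreover have "u = 0" if "A' *v u = r *\<^sub>R u" for u
    proof -
      have A': "A' *v u = A *v u - (r * (f \<bullet> u)) *\<^sub>R a"
        by (simp add: vec_eq_iff A'_def matrix_vector_mult_def inner_vec_def algebra_simps sum_subtractf sum_distrib_left)
      then have "f \<bullet> (A' *v u) = 0" using fA[of u] assms(3) by (simp add: inner_diff_right)
      then have "f \<bullet> u = 0" using that assms(4) by simp
      then show "u = 0" using eigenspace[of u] that A' by simp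
    qed
    ultimately have "x = 0" "y = 0" by auto
    then show False using v(1) xy by (simp add: complex_vec_def vec_eq_iff)
  qed
  then have "char_poly A' \<noteq> 0" by auto
  then have n1: "?l * char_poly A' \<noteq> 0"
    unfolding mult_eq_0_iff by (simp only: pCons_eq_0_iff one_neq_zero simp_thms)
  then have n2: "[:0, 1:] * char_poly A \<noteq> 0" unfolding eq .
  have "order (complex_of_real r) (?l * char_poly A') = 1"
    using order_mult[OF n1, of "complex_of_real r"] order_0I[OF nz] order_power_n_n[of "complex_of_real r" 1] by simp
  moreover have "order (complex_of_real r) ([:0, 1:] * char_poly A) = order (complex_of_real r) (char_poly A)"
    using order_mult[OF n2, of "complex_of_real r"] order_0I[of "[:0, 1:]" "complex_of_real r"] assms(4) by simp
  ultimately show ?thesis unfolding eq by simp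
qed

section \<open>Compact slices of closed cones\<close>

text \<open>By homogeneity the minimum of \<open>h\<close> over the unit vectors of \<open>K\<close>
  serves as \<open>m\<close>; a cone without unit vectors is treated apart.\<close>

lemma cone_functional_bound:
  fixes K :: "'a::euclidean_space set"
  assumes "closed K" and scale: "\<And>x c. x \<in> K \<Longrightarrow> 0 \<le> c \<Longrightarrow> c *\<^sub>R x \<in> K"
    and pos: "\<And>x. x \<in> K \<Longrightarrow> x \<noteq> 0 \<Longrightarrow> 0 < h \<bullet> x"
  obtains m where "m > 0" "\<And>x. x \<in> K \<Longrightarrow> m * norm x \<le> h \<bullet> x"
proof (cases "K \<inter> sphere 0 1 = {}")
  case True
  have "x = 0" if "x \<in> K" for x
  proof (rule ccontr)
    assume "x \<noteq> 0"
    then have "(1 / norm x) *\<^sub>R x \<in> K \<inter> sphere 0 1" using scale[OF that, of "1 / norm x"] by simp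
    then show False using True by blast
  qed
  then show ?thesis using that[of 1] by fastforce
next
  case False
  have "compact (K \<inter> sphere 0 1)" using assms(1) by (simp add: closed_Int_compact)
  moreover have "continuous_on (K \<inter> sphere 0 1) (\<lambda>x. h \<bullet> x)" by (intro continuous_intros)
  ultimately obtain u where u: "u \<in> K \<inter> sphere 0 1" "\<And>x. x \<in> K \<inter> sphere 0 1 \<Longrightarrow> h \<bullet> u \<le> h \<bullet> x"
    using continuous_attains_inf False by metis
  have "h \<bullet> u * norm x \<le> h \<bullet> x" if "x \<in> K" for x
  proof (cases "x = 0")
    case False
    then have "(1 / norm x) *\<^sub>R x \<in> K \<inter> sphere 0 1" using scale[OF that, of "1 / norm x"] by simp
    from u(2)[OF this] show ?thesis using False by (simp add: field_simps)
  qed simp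
  moreover have "u \<noteq> 0" using u(1) by auto
  then have "h \<bullet> u > 0" using u(1) pos by auto
  ultimately show ?thesis using that by blast
qed

lemma compact_cone_slice:
  fixes K :: "'a::euclidean_space set"
  assumes "closed K" "\<And>x c. x \<in> K \<Longrightarrow> 0 \<le> c \<Longrightarrow> c *\<^sub>R x \<in> K"
    "\<And>x. x \<in> K \<Longrightarrow> x \<noteq> 0 \<Longrightarrow> 0 < h \<bullet> x"
  shows "compact {x \<in> K. h \<bullet> x = 1}"
proof -
  obtain m where m: "m > 0" "\<And>x. x \<in> K \<Longrightarrow> m * norm x \<le> h \<bullet> x"
    using cone_functional_bound[OF assms] by metis
  have "norm x \<le> 1 / m" if "x \<in> {x \<in> K. h \<bullet> x = 1}" for x
    using m(2)[of x] m(1) that by (simp add: field_simps)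
  then have "bounded {x \<in> K. h \<bullet> x = 1}" unfolding bounded_iff by blast
  moreover have "{x \<in> K. h \<bullet> x = 1} = K \<inter> {x. h \<bullet> x = 1}" by auto
  then have "closed {x \<in> K. h \<bullet> x = 1}" using assms(1) closed_hyperplane by auto
  ultimately show ?thesis using compact_eq_bounded_closed by blast
qed

section \<open>Cones with an axis\<close>

text \<open>\<open>C\<close> is the open cone over the domain, \<open>K\<close> its closure, \<open>A\<close> a lift of the isometry with inverse \<open>B\<close>,
  and \<open>a\<close>, \<open>b\<close> span the axis. That the axis is in no half triangle is the last assumption.
  Exchanging \<open>A\<close> with \<open>B\<close> and \<open>a\<close> with \<open>b\<close> is a symmetry of the hypotheses.\<close>

locale cone_axis =
  fixes C K :: "(real ^ 'n::finite) set" and w a b :: "real ^ 'n" and A B :: "real ^ 'n ^ 'n"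
    and \<alpha> \<beta> :: real
  assumes open_C: "open C" and C_sub_K: "C \<subseteq> K" and closed_K: "closed K"
    and K_add: "\<And>x y. x \<in> K \<Longrightarrow> y \<in> K \<Longrightarrow> x + y \<in> K"
    and K_scale: "\<And>x c. x \<in> K \<Longrightarrow> 0 \<le> c \<Longrightarrow> c *\<^sub>R x \<in> K"
    and w_pos: "\<And>x. x \<in> K \<Longrightarrow> x \<noteq> 0 \<Longrightarrow> 0 < w \<bullet> x"
    and AB: "\<And>x. A *v (B *v x) = x" and BA: "\<And>x. B *v (A *v x) = x"
    and A_K: "\<And>x. x \<in> K \<Longrightarrow> A *v x \<in> K" and B_K: "\<And>x. x \<in> K \<Longrightarrow> B *v x \<in> K"
    and A_a: "A *v a = \<alpha> *\<^sub>R a" and A_b: "A *v b = \<beta> *\<^sub>R b"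
    and ev: "0 < \<beta>" "\<beta> < \<alpha>"
    and a_K: "a \<in> K" and b_K: "b \<in> K" and a_nz: "a \<noteq> 0" and b_nz: "b \<noteq> 0"
    and ab_C: "a + b \<in> C"
    and no_half_triangle: "\<And>z. z \<in> K \<Longrightarrow> z \<noteq> 0 \<Longrightarrow> z + a \<in> C \<or> z + b \<in> C"
begin

lemma dual: "cone_axis C K w b a B A (1 / \<beta>) (1 / \<alpha>)"
proof
  have "\<beta> *\<^sub>R (B *v b) = b" using BA[of b] A_b by (simp add: matrix_vector_mult_scaleR)
  then show "B *v b = (1 / \<beta>) *\<^sub>R b" using ev
    by (metis divideR_right less_numeral_extra(3) inverse_eq_divide)
  have "\<alpha> *\<^sub>R (B *v a) = a" using BA[of a] A_a by (simp add: matrix_vector_mult_scaleR)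
  then show "B *v a = (1 / \<alpha>) *\<^sub>R a" using ev
    by (metis divideR_right less_numeral_extra(3) inverse_eq_divide less_trans)
  show "0 < 1 / \<alpha>" "1 / \<alpha> < 1 / \<beta>" using ev by (auto simp: field_simps)
  show "z + b \<in> C \<or> z + a \<in> C" if "z \<in> K" "z \<noteq> 0" for z using no_half_triangle[OF that] by blast
  show "b + a \<in> C" using ab_C by (simp add: add.commute)
qed (use open_C C_sub_K closed_K K_add K_scale w_pos AB BA A_K B_K a_K b_K a_nz b_nz in auto)

text \<open>The rescaling leaves the projective action unchanged, while \<open>a\<close> becomes a
  fixed vector and \<open>f\<close> an invariant functional.\<close>

definition S :: "real ^ 'n \<Rightarrow> real ^ 'n" where "S x = (1 / \<alpha>) *\<^sub>R (A *v x)"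

lemma linear_S: "linear S"
  unfolding S_def
  by (rule linearI) (simp_all add: matrix_vector_right_distrib scaleR_right_distrib matrix_vector_mult_scaleR)

lemma S_a: "(S ^^ n) a = a"
  using ev by (induction n) (simp_all add: S_def A_a)

lemma S_b: "(S ^^ n) b = (\<beta> / \<alpha>) ^ n *\<^sub>R b"
  by (induction n) (simp_all add: S_def A_b matrix_vector_mult_scaleR mult.commute)

lemma linear_S_pow: "linear (S ^^ n)"
proof (induction n)
  case (Suc n)
  then show ?case using linear_compose[OF Suc linear_S] by (simp add: o_def)
qed (simp add: linear_id[unfolded id_def])

lemma S_K: "x \<in> K \<Longrightarrow> (S ^^ n) x \<in> K"
  by (induction n) (use ev in \<open>auto simp: S_def intro!: K_scale A_K\<close>)

text \<open>Since \<open>a + b \<plusminus> t v\<close> is in \<open>K\<close> for small \<open>t\<close>, the functionals \<open>w \<circ> S\<^sup>n\<close> are bounded; a limit of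
  their Cesaro means is invariant under \<open>S\<close>.\<close>

lemma dual_eigenvector:
  obtains f where "\<And>x. x \<in> K \<Longrightarrow> 0 \<le> f \<bullet> x" "\<And>x. f \<bullet> (A *v x) = \<alpha> * (f \<bullet> x)"
    "f \<bullet> a = 1" "f \<bullet> b = 0"
proof -
  define u where "u n = (adjoint S ^^ n) w" for n
  have u: "u n \<bullet> x = w \<bullet> (S ^^ n) x" for n x
  proof (induction n arbitrary: x)
    case (Suc n)
    have "u (Suc n) \<bullet> x = S x \<bullet> u n"
      using adjoint_works[OF linear_S, of x "u n"] by (simp add: u_def inner_commute)
    then show ?case using Suc[of "S x"] by (simp add: inner_commute funpow_swap1)
  qed (simp add: u_def)
  have w_nonneg: "0 \<le> w \<bullet> x" if "x \<in> K" for x using w_pos[OF that] by (cases "x = 0") auto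
  obtain r where r: "r > 0" "cball (a + b) r \<subseteq> C" using open_C ab_C open_contains_cball by blast
  define M where "M = (w \<bullet> a + w \<bullet> b) / r"
  have u_bound: "norm (u n) \<le> M" for n
  proof -
    \<comment> \<open>This is the point of the ball where \<open>u n\<close> is smallest;
      nonnegativity there bounds the norm of \<open>u n\<close> by its value at
      \<open>a + b\<close>.\<close>
    have "a + b - r *\<^sub>R sgn (u n) \<in> cball (a + b) r" using r(1) by (simp add: dist_norm norm_sgn)
    then have "0 \<le> u n \<bullet> (a + b - r *\<^sub>R sgn (u n))"
      unfolding u using r(2) C_sub_K by (intro w_nonneg S_K) blast
    moreover have "u n \<bullet> sgn (u n) = norm (u n)"
      by (cases "u n = 0") (simp_all add: sgn_div_norm power2_norm_eq_inner[symmetric] power2_eq_square)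
    ultimately have "r * norm (u n) \<le> u n \<bullet> a + u n \<bullet> b" by (simp add: algebra_simps)
    also have "\<dots> = w \<bullet> a + (\<beta> / \<alpha>) ^ n * (w \<bullet> b)" by (simp add: u S_a S_b)
    also have "\<dots> \<le> w \<bullet> a + w \<bullet> b"
      using ev w_nonneg[OF b_K] by (simp add: mult_left_le_one_le power_le_one)
    finally show ?thesis using r(1) by (simp add: M_def field_simps)
  qed
  define c where "c N = (1 / real (Suc N)) *\<^sub>R (\<Sum>n\<le>N. u n)" for N
  have c: "c N \<bullet> x = (1 / real (Suc N)) * (\<Sum>n\<le>N. w \<bullet> (S ^^ n) x)" for N x
    by (simp add: c_def inner_sum_left u)
  have "c N \<in> cball 0 M" for N
  proof -
    have "norm (\<Sum>n\<le>N. u n) \<le> (\<Sum>n\<le>N. M)" by (rule sum_norm_le) (rule u_bound)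
    then show ?thesis by (simp add: c_def field_simps)
  qed
  then obtain f0 \<sigma> where f0: "strict_mono \<sigma>" "(c \<circ> \<sigma>) \<longlonglongrightarrow> f0"
    using compact_cball[of 0 M] unfolding compact_def by metis
  have lim: "(\<lambda>N. c (\<sigma> N) \<bullet> x) \<longlonglongrightarrow> f0 \<bullet> x" for x
    using f0(2) by (auto simp: o_def intro: tendsto_intros)
  have f0_nonneg: "0 \<le> f0 \<bullet> x" if "x \<in> K" for x
  proof (rule LIMSEQ_le_const[OF lim])
    show "\<exists>N. \<forall>n\<ge>N. 0 \<le> c (\<sigma> n) \<bullet> x"
      using that by (auto simp: c intro!: sum_nonneg divide_nonneg_nonneg w_nonneg S_K)
  qed
  have f0_S: "f0 \<bullet> S x = f0 \<bullet> x" for x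
  proof -
    \<comment> \<open>The sums telescope, so the defect of invariance of the mean is a bounded
      quantity divided by \<open>N + 1\<close>.\<close>
    have diff: "c N \<bullet> S x - c N \<bullet> x = (1 / real (Suc N)) * (u (Suc N) \<bullet> x - u 0 \<bullet> x)" for N
    proof -
      have "(\<Sum>n\<le>N. w \<bullet> (S ^^ n) (S x)) - (\<Sum>n\<le>N. w \<bullet> (S ^^ n) x)
          = (\<Sum>n\<le>N. u (Suc n) \<bullet> x - u n \<bullet> x)"
        by (simp add: u sum_subtractf funpow_swap1)
      also have "\<dots> = u (Suc N) \<bullet> x - u 0 \<bullet> x"
        by (induction N) auto
      finally show ?thesis unfolding c by (metis right_diff_distrib)
    qed
    have "norm (c (\<sigma> N) \<bullet> S x - c (\<sigma> N) \<bullet> x) \<le> (2 * M * norm x) * (1 / real (Suc N))" for N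
    proof -
      have "\<bar>u k \<bullet> x\<bar> \<le> M * norm x" for k
        using Cauchy_Schwarz_ineq2[of "u k" x] u_bound[of k] mult_right_mono[OF u_bound norm_ge_zero]
        by (meson order_trans)
      from this[of "Suc (\<sigma> N)"] this[of 0]
      have 1: "\<bar>u (Suc (\<sigma> N)) \<bullet> x - u 0 \<bullet> x\<bar> \<le> 2 * M * norm x" by linarith
      have 2: "1 / real (Suc (\<sigma> N)) \<le> 1 / real (Suc N)"
        using seq_suble[OF f0(1), of N] by (simp add: field_simps)
      have "\<bar>u (Suc (\<sigma> N)) \<bullet> x - u 0 \<bullet> x\<bar> * (1 / real (Suc (\<sigma> N))) \<le> (2 * M * norm x) * (1 / real (Suc N))"
        using 1 2 by (intro mult_mono) auto
      then show ?thesis unfolding diff by (simp add: abs_mult mult.commute)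
    qed
    moreover have "(\<lambda>N. (2 * M * norm x) * (1 / real (Suc N))) \<longlonglongrightarrow> 0"
      by (rule tendsto_mult_right_zero[OF LIMSEQ_Suc[OF lim_1_over_n]])
    ultimately have "(\<lambda>N. c (\<sigma> N) \<bullet> S x - c (\<sigma> N) \<bullet> x) \<longlonglongrightarrow> 0"
      by (rule Lim_null_comparison[OF always_eventually[OF allI]])
    moreover have "(\<lambda>N. c (\<sigma> N) \<bullet> S x - c (\<sigma> N) \<bullet> x) \<longlonglongrightarrow> f0 \<bullet> S x - f0 \<bullet> x"
      by (intro tendsto_diff lim)
    ultimately show ?thesis using LIMSEQ_unique by fastforce
  qed
  \<comment> \<open>Every mean takes the value \<open>w \<bullet> a\<close> at the fixed vector
    \<open>a\<close>. Hence the limit is not zero and can be normalised at \<open>a\<close>.\<close>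
  have wa: "w \<bullet> a > 0" using w_pos a_K a_nz by blast
  have "(\<lambda>N. c (\<sigma> N) \<bullet> a) = (\<lambda>N. w \<bullet> a)" by (auto simp: c S_a)
  then have f0_a: "f0 \<bullet> a = w \<bullet> a" using lim[of a] by (simp add: LIMSEQ_const_iff)
  have "f0 \<bullet> b = \<beta> / \<alpha> * (f0 \<bullet> b)" using f0_S[of b] S_b[of 1] by simp
  then have "\<alpha> * (f0 \<bullet> b) = \<beta> * (f0 \<bullet> b)" using ev by (simp add: field_simps)
  then have f0_b: "f0 \<bullet> b = 0" using ev by auto
  have f0_A: "f0 \<bullet> (A *v x) = \<alpha> * (f0 \<bullet> x)" for x
    using f0_S[of x] ev unfolding S_def by (simp add: field_simps)
  show ?thesis
    by (rule that[of "(1 / (w \<bullet> a)) *\<^sub>R f0"]) (use wa f0_nonneg f0_A f0_a f0_b in auto)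
qed

end

text \<open>The functionals are parameters so that the symmetry between \<open>A\<close> and
  \<open>B\<close> can exchange this very pair; each fact about \<open>a\<close> and
  \<open>f\<close> then has its counterpart for \<open>b\<close> and \<open>g\<close>.\<close>

locale cone_axis_dual = cone_axis C K w a b A B \<alpha> \<beta>
  for C K :: "(real ^ 'n::finite) set" and w a b :: "real ^ 'n" and A B :: "real ^ 'n ^ 'n"
    and \<alpha> \<beta> :: real +
  fixes f g :: "real ^ 'n"
  assumes f_nonneg: "\<And>x. x \<in> K \<Longrightarrow> 0 \<le> f \<bullet> x" and g_nonneg: "\<And>x. x \<in> K \<Longrightarrow> 0 \<le> g \<bullet> x"
    and f_A: "\<And>x. f \<bullet> (A *v x) = \<alpha> * (f \<bullet> x)" and g_A: "\<And>x. g \<bullet> (A *v x) = \<beta> * (g \<bullet> x)"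
    and f_a: "f \<bullet> a = 1" and f_b: "f \<bullet> b = 0" and g_a: "g \<bullet> a = 0" and g_b: "g \<bullet> b = 1"

text \<open>\<open>g\<close> is the invariant functional of the inverse, for which \<open>b\<close>
  is the end with the larger eigenvalue.\<close>

lemma (in cone_axis) obtain_dual:
  obtains f g where "cone_axis_dual C K w a b A B \<alpha> \<beta> f g"
proof -
  obtain f where f: "\<And>x. x \<in> K \<Longrightarrow> 0 \<le> f \<bullet> x" "\<And>x. f \<bullet> (A *v x) = \<alpha> * (f \<bullet> x)"
    "f \<bullet> a = 1" "f \<bullet> b = 0" using dual_eigenvector by blast
  obtain g where g: "\<And>x. x \<in> K \<Longrightarrow> 0 \<le> g \<bullet> x" "\<And>x. g \<bullet> (B *v x) = (1 / \<beta>) * (g \<bullet> x)"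
    "g \<bullet> b = 1" "g \<bullet> a = 0" using cone_axis.dual_eigenvector[OF dual] by blast
  have "g \<bullet> (A *v x) = \<beta> * (g \<bullet> x)" for x
    using g(2)[of "A *v x"] ev by (simp add: BA field_simps)
  then have "cone_axis_dual C K w a b A B \<alpha> \<beta> f g" using f g by unfold_locales auto
  then show ?thesis using that by blast
qed

section \<open>Dynamics on the cone\<close>

context cone_axis_dual
begin

lemma f_B: "f \<bullet> (B *v x) = (1 / \<alpha>) * (f \<bullet> x)"
  using f_A[of "B *v x"] ev by (simp add: AB field_simps)

lemma g_B: "g \<bullet> (B *v x) = (1 / \<beta>) * (g \<bullet> x)"
  using g_A[of "B *v x"] ev by (simp add: AB field_simps)

lemma dual_pair: "cone_axis_dual C K w b a B A (1 / \<beta>) (1 / \<alpha>) g f"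
proof -
  interpret d: cone_axis C K w b a B A "1 / \<beta>" "1 / \<alpha>" by (rule dual)
  show ?thesis
    by unfold_locales (use f_nonneg g_nonneg f_a f_b g_a g_b f_B g_B in auto)
qed

text \<open>From a point of the open set \<open>C\<close> one can move a little against
  \<open>a\<close> and stay in \<open>K\<close>, while \<open>f\<close> strictly decreases along the
  way.\<close>

lemma f_pos:
  assumes "x \<in> C"
  shows "0 < f \<bullet> x"
proof -
  obtain e where e: "e > 0" "cball x e \<subseteq> C" using open_C assms open_contains_cball by blast
  have "x - (e / norm a) *\<^sub>R a \<in> cball x e" using e(1) a_nz by (simp add: dist_norm)
  then have "0 \<le> f \<bullet> (x - (e / norm a) *\<^sub>R a)" using e(2) C_sub_K f_nonneg by blast
  then have "e / norm a \<le> f \<bullet> x" by (simp add: inner_diff_right f_a)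
  moreover have "0 < e / norm a" using e(1) a_nz by simp
  ultimately show ?thesis by linarith
qed

lemma g_pos: "x \<in> C \<Longrightarrow> 0 < g \<bullet> x"
  using cone_axis_dual.f_pos[OF dual_pair] .

text \<open>\<open>f\<close> does not distinguish \<open>z\<close> from \<open>z + b\<close>, nor
  \<open>g\<close> from \<open>z + a\<close>; whichever of the two sums lies in \<open>C\<close>
  makes the corresponding functional positive at \<open>z\<close>.\<close>

lemma fg_pos:
  assumes "z \<in> K" "z \<noteq> 0"
  shows "0 < (f + g) \<bullet> z"
proof -
  have "0 < f \<bullet> z \<or> 0 < g \<bullet> z"
    using no_half_triangle[OF assms] f_pos[of "z + b"] g_pos[of "z + a"]
    by (auto simp: inner_add_right f_b g_a)
  then show ?thesis
    using f_nonneg[OF assms(1)] g_nonneg[OF assms(1)] by (auto simp: inner_add_left)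
qed

lemma f_S: "f \<bullet> (S ^^ n) x = f \<bullet> x"
  using ev by (induction n) (simp_all add: S_def f_A)

lemma g_S: "g \<bullet> (S ^^ n) x = (\<beta> / \<alpha>) ^ n * (g \<bullet> x)"
  by (induction n) (simp_all add: S_def g_A)

lemma ratio_tendsto_0: "(\<lambda>n. (\<beta> / \<alpha>) ^ n) \<longlonglongrightarrow> 0"
  using ev by (intro LIMSEQ_power_zero) simp

text \<open>Pull \<open>z\<^sub>1\<close> and \<open>z\<^sub>2\<close> back by \<open>S\<^sup>n\<close>, use that \<open>D + b\<close> is uniformly inside \<open>C\<close>, and push forward
  again: the contribution of \<open>b\<close> vanishes in the limit.\<close>

lemma face_expand:
  assumes "compact D" "D \<subseteq> K"
    and D: "\<And>z. z \<in> D \<Longrightarrow> z + b \<in> C" and B_D: "\<And>z. z \<in> D \<Longrightarrow> \<alpha> *\<^sub>R (B *v z) \<in> D"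
  obtains e where "e > 0" "\<And>z1 z2. z1 \<in> D \<Longrightarrow> z2 \<in> D \<Longrightarrow> z1 + e *\<^sub>R (z1 - z2) \<in> K"
proof -
  have "compact ((\<lambda>z. z + b) ` D)" using assms(1) by (intro compact_continuous_image continuous_intros)
  moreover have "(\<lambda>z. z + b) ` D \<subseteq> C" using D by auto
  ultimately obtain r where r: "r > 0" "(\<Union>x\<in>(\<lambda>z. z + b) ` D. ball x r) \<subseteq> C"
    using compact_subset_open_imp_ball_epsilon_subset open_C by metis
  obtain R where R: "R > 0" "\<And>z. z \<in> D \<Longrightarrow> norm z \<le> R" using compact_imp_bounded[OF assms(1)] bounded_pos by blast
  \<comment> \<open>Two points of \<open>D\<close> differ by at most \<open>2 * R\<close>, so the
    displacement below has norm at most \<open>r / 2\<close>.\<close>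
  define e where "e = r / (4 * R)"
  have e: "e > 0" using r(1) R(1) by (simp add: e_def)
  define T where "T z = \<alpha> *\<^sub>R (B *v z)" for z
  have ST: "S (T z) = z" for z
    using ev by (simp add: S_def T_def matrix_vector_mult_scaleR AB)
  have STn: "(S ^^ n) ((T ^^ n) z) = z" for n z
  proof (induction n)
    case (Suc n)
    have "(S ^^ Suc n) ((T ^^ Suc n) z) = (S ^^ n) (S (T ((T ^^ n) z)))"
      by (simp add: funpow_swap1[of S n])
    then show ?case by (simp only: ST Suc)
  qed simp
  have TD: "z \<in> D \<Longrightarrow> (T ^^ n) z \<in> D" for n z
    by (induction n) (auto simp: T_def B_D)
  have "z1 + e *\<^sub>R (z1 - z2) \<in> K" if "z1 \<in> D" "z2 \<in> D" for z1 z2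
  proof -
    have "z1 + (\<beta> / \<alpha>) ^ n *\<^sub>R b + e *\<^sub>R (z1 - z2) \<in> K" for n
    proof -
      let ?y = "(T ^^ n) z1" and ?y' = "(T ^^ n) z2"
      have "norm (?y - ?y') \<le> R + R"
        using R(2)[OF TD[OF that(1), of n]] R(2)[OF TD[OF that(2), of n]] norm_triangle_ineq4[of ?y ?y']
        by linarith
      then have "norm (e *\<^sub>R (?y - ?y')) \<le> e * (R + R)"
        using e by (simp add: mult_left_mono)
      also have "\<dots> < r" using r(1) R(1) by (simp add: e_def)
      finally have "?y + b + e *\<^sub>R (?y - ?y') \<in> ball (?y + b) r" 
        by (metis add_diff_cancel_left' dist_norm dist_commute mem_ball)
      then have "?y + b + e *\<^sub>R (?y - ?y') \<in> K" using r(2) TD[OF that(1)] C_sub_K by blast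
      from S_K[OF this, of n] show ?thesis
        by (simp add: linear_add[OF linear_S_pow] linear_diff[OF linear_S_pow]
            linear_scale[OF linear_S_pow] STn S_b)
    qed
    moreover have "(\<lambda>n. z1 + (\<beta> / \<alpha>) ^ n *\<^sub>R b + e *\<^sub>R (z1 - z2)) \<longlonglongrightarrow> z1 + 0 *\<^sub>R b + e *\<^sub>R (z1 - z2)"
      by (intro tendsto_intros ratio_tendsto_0)
    ultimately have "z1 + 0 *\<^sub>R b + e *\<^sub>R (z1 - z2) \<in> K" by (rule closed_sequentially[OF closed_K])
    then show ?thesis by simp
  qed
  then show ?thesis using that e by blast
qed

text \<open>Expanding a diametral pair of the compact slice \<open>D\<close> would exceed the diameter, so \<open>D = {a}\<close>.\<close>

lemma g_zero_ray:
  assumes "z \<in> K" "g \<bullet> z = 0"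
  shows "z = (f \<bullet> z) *\<^sub>R a"
proof -
  define D where "D = {z \<in> K \<inter> {z. g \<bullet> z = 0}. f \<bullet> z = 1}"
  have "compact D" unfolding D_def
  proof (rule compact_cone_slice)
    show "closed (K \<inter> {z. g \<bullet> z = 0})" using closed_K closed_hyperplane by auto
    show "0 < f \<bullet> x" if "x \<in> K \<inter> {z. g \<bullet> z = 0}" "x \<noteq> 0" for x
      using fg_pos[of x] that by (simp add: inner_add_left)
  qed (auto simp: K_scale)
  moreover have "D \<subseteq> K" by (auto simp: D_def)
  \<comment> \<open>On the face, \<open>g\<close> vanishes at \<open>z + a\<close>, which therefore
    is not in \<open>C\<close>; only the other alternative remains.\<close>
  moreover have "z + b \<in> C" if "z \<in> D" for z
  proof -
    have "z \<noteq> 0" "z \<in> K" "\<not> z + a \<in> C" using that g_pos[of "z + a"] by (auto simp: D_def inner_add_right g_a)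
    then show ?thesis using no_half_triangle by blast
  qed
  moreover have "\<alpha> *\<^sub>R (B *v z) \<in> D" if "z \<in> D" for z
    using that ev by (auto simp: D_def f_B g_B intro: K_scale B_K)
  ultimately obtain e where e: "e > 0" "\<And>z1 z2. z1 \<in> D \<Longrightarrow> z2 \<in> D \<Longrightarrow> z1 + e *\<^sub>R (z1 - z2) \<in> K"
    using face_expand[of D] \<open>compact D\<close> \<open>D \<subseteq> K\<close> by metis
  have aD: "a \<in> D" using a_K f_a g_a by (simp add: D_def)
  obtain z1 z2 where z: "z1 \<in> D" "z2 \<in> D" "dist z1 z2 = diameter D"
    using diameter_compact_attained[OF \<open>compact D\<close>] aD by blast
  \<comment> \<open>The direction \<open>z1 - z2\<close> is annihilated by \<open>f\<close> and
    \<open>g\<close>, so membership in \<open>K\<close> is all that has to be checked.\<close>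
  have "z1 + e *\<^sub>R (z1 - z2) \<in> D"
    using e(2)[OF z(1,2)] z(1,2) by (auto simp: D_def inner_add_right inner_diff_right)
  then have "dist (z1 + e *\<^sub>R (z1 - z2)) z2 \<le> dist z1 z2"
    using diameter_bounded_bound[OF compact_imp_bounded[OF \<open>compact D\<close>]] z(2,3) by simp
  moreover have "z1 + e *\<^sub>R (z1 - z2) - z2 = (1 + e) *\<^sub>R (z1 - z2)" by (simp add: algebra_simps)
  ultimately have "(1 + e) * norm (z1 - z2) \<le> norm (z1 - z2)" using e(1) by (simp add: dist_norm)
  then have "diameter D = 0" using e(1) z(3) by (simp add: dist_norm algebra_simps mult_le_0_iff)
  then have D_a: "y = a" if "y \<in> D" for y
    using diameter_bounded_bound[OF compact_imp_bounded[OF \<open>compact D\<close>] that aD] by simp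
  show ?thesis
  proof (cases "z = 0")
    case False
    then have "0 < f \<bullet> z" using fg_pos[OF assms(1)] assms(2) by (simp add: inner_add_left)
    then have "(1 / (f \<bullet> z)) *\<^sub>R z \<in> D" using assms by (auto simp: D_def intro: K_scale)
    from D_a[OF this] show ?thesis using \<open>0 < f \<bullet> z\<close> by auto
  qed simp
qed

text \<open>By \<open>g_zero_ray\<close>, \<open>a\<close> is the only zero of \<open>g\<close> on
  the slice. Outside a ball around \<open>a\<close> the slice is compact, so \<open>g\<close> has a
  positive minimum there.\<close>

lemma near_a:
  assumes "e > 0"
  obtains d where "d > 0" "\<And>x. x \<in> K \<Longrightarrow> (f + g) \<bullet> x = 1 \<Longrightarrow> g \<bullet> x < d \<Longrightarrow> dist x a < e"
proof (cases "{x \<in> K. (f + g) \<bullet> x = 1} - ball a e = {}")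
  case True
  then have "dist x a < e" if "x \<in> K" "(f + g) \<bullet> x = 1" for x
    using that by (force simp: dist_commute)
  then show ?thesis using that[of 1] by auto
next
  case False
  let ?X = "{x \<in> K. (f + g) \<bullet> x = 1} - ball a e"
  have "compact ?X" by (intro compact_diff compact_cone_slice closed_K K_scale fg_pos) auto
  moreover have "continuous_on ?X (\<lambda>x. g \<bullet> x)" by (intro continuous_intros)
  ultimately obtain u where u: "u \<in> ?X" "\<And>x. x \<in> ?X \<Longrightarrow> g \<bullet> u \<le> g \<bullet> x"
    using continuous_attains_inf[of ?X "\<lambda>x. g \<bullet> x"] False by blast
  have "g \<bullet> u \<noteq> 0"
  proof
    assume "g \<bullet> u = 0"
    moreover from this have "f \<bullet> u = 1" using u(1) by (simp add: inner_add_left)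
    ultimately have "u = a" using g_zero_ray[of u] u(1) by simp
    then show False using u(1) assms by simp
  qed
  then have "g \<bullet> u > 0" using g_nonneg u(1) by (metis (no_types, lifting) DiffD1 mem_Collect_eq order_le_less)
  moreover have "dist x a < e" if "x \<in> K" "(f + g) \<bullet> x = 1" "g \<bullet> x < g \<bullet> u" for x
    using u(2)[of x] that by (force simp: dist_commute)
  ultimately show ?thesis using that by blast
qed

text \<open>On the slice \<open>g\<close> is bounded by the ratio \<open>g / f\<close>, which after
  \<open>n\<close> steps is at most \<open>(\<beta> / \<alpha>) ^ n\<close> times its maximum
  \<open>M\<close> on \<open>Q\<close>; \<open>near_a\<close> converts this into closeness to
  \<open>a\<close>.\<close>

lemma uniform_dynamics:
  assumes "compact Q" "Q \<subseteq> K" and f_Q: "\<And>x. x \<in> Q \<Longrightarrow> 0 < f \<bullet> x" and "e > 0"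
  shows "\<forall>\<^sub>F n in sequentially. \<forall>x\<in>Q. dist ((1 / ((f + g) \<bullet> (S ^^ n) x)) *\<^sub>R (S ^^ n) x) a < e"
proof (cases "Q = {}")
  case False
  obtain d where d: "d > 0" "\<And>x. x \<in> K \<Longrightarrow> (f + g) \<bullet> x = 1 \<Longrightarrow> g \<bullet> x < d \<Longrightarrow> dist x a < e"
    using near_a[OF \<open>e > 0\<close>] by blast
  have "continuous_on Q (\<lambda>x. (g \<bullet> x) / (f \<bullet> x))"
    by (intro continuous_intros) (use f_Q in fastforce)
  then obtain y where y: "\<And>x. x \<in> Q \<Longrightarrow> (g \<bullet> x) / (f \<bullet> x) \<le> (g \<bullet> y) / (f \<bullet> y)"
    using continuous_attains_sup[OF assms(1) False, of "\<lambda>x. (g \<bullet> x) / (f \<bullet> x)"] by blast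
  define M where "M = (g \<bullet> y) / (f \<bullet> y)"
  have "(\<lambda>n. (\<beta> / \<alpha>) ^ n * M) \<longlonglongrightarrow> 0" using tendsto_mult_left_zero[OF ratio_tendsto_0] .
  then have "\<forall>\<^sub>F n in sequentially. (\<beta> / \<alpha>) ^ n * M < d" using d(1) by (rule order_tendstoD)
  then show ?thesis
  proof eventually_elim
    case (elim n)
    show ?case
    proof
      fix x assume x: "x \<in> Q"
      let ?x = "(S ^^ n) x" and ?q = "(\<beta> / \<alpha>) ^ n"
      have f: "0 < f \<bullet> x" and g: "0 \<le> g \<bullet> x" and q: "0 \<le> ?q"
        using x f_Q g_nonneg assms(2) ev by auto
      have s: "(f + g) \<bullet> ?x = f \<bullet> x + ?q * (g \<bullet> x)" by (simp add: inner_add_left f_S g_S)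
      then have s_pos: "0 < (f + g) \<bullet> ?x" using f g q by (simp add: add_pos_nonneg)
      have "g \<bullet> ((1 / ((f + g) \<bullet> ?x)) *\<^sub>R ?x) = ?q * (g \<bullet> x) / (f \<bullet> x + ?q * (g \<bullet> x))"
        by (simp add: g_S s)
      also have "\<dots> \<le> ?q * (g \<bullet> x) / (f \<bullet> x)"
        using f g q by (intro divide_left_mono) (auto intro!: mult_pos_pos add_pos_nonneg)
      also have "\<dots> \<le> ?q * M" using y[OF x] q unfolding M_def by (metis mult_left_mono times_divide_eq_right)
      finally have "g \<bullet> ((1 / ((f + g) \<bullet> ?x)) *\<^sub>R ?x) < d" using elim by linarith
      moreover have "(1 / ((f + g) \<bullet> ?x)) *\<^sub>R ?x \<in> K" using s_pos x assms(2) by (intro K_scale S_K) auto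
      ultimately show "dist ((1 / ((f + g) \<bullet> ?x)) *\<^sub>R ?x) a < e" using s_pos by (intro d(2)) auto
    qed
  qed
qed simp

text \<open>The orbit of \<open>x\<close> converges to \<open>a\<close> even before normalisation,
  because the normalising factors tend to \<open>f \<bullet> x = 1\<close>. Removing the
  contributions of \<open>a\<close> and \<open>b\<close> leaves \<open>t\<close> times the orbit of
  \<open>v\<close>.\<close>

lemma kernel_contracted:
  assumes "f \<bullet> v = 0"
  shows "(\<lambda>n. (S ^^ n) v) \<longlonglongrightarrow> 0"
proof -
  obtain r where r: "r > 0" "cball (a + b) r \<subseteq> C" using open_C ab_C open_contains_cball by blast
  \<comment> \<open>Small enough to keep \<open>x\<close> in the ball; the summand 1 covers
    \<open>v = 0\<close>.\<close>
  define t where "t = r / (norm v + 1)"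
  have nv: "norm v + 1 > 0" by (simp add: add_nonneg_pos)
  have t: "t > 0" using r(1) nv by (simp add: t_def)
  define x where "x = a + b + t *\<^sub>R v"
  have "t * norm v \<le> r" using r(1) nv by (simp add: t_def field_simps)
  then have "x \<in> cball (a + b) r" using t by (simp add: x_def dist_norm)
  then have xK: "x \<in> K" using r(2) C_sub_K by blast
  have fx: "f \<bullet> x = 1" by (simp add: x_def inner_add_right f_a f_b assms)
  define s where "s n = (f + g) \<bullet> (S ^^ n) x" for n
  have s: "s n = 1 + (\<beta> / \<alpha>) ^ n * (g \<bullet> x)" for n
    by (simp add: s_def inner_add_left f_S g_S fx)
  have s_lim: "s \<longlonglongrightarrow> 1"
    unfolding s using tendsto_add[OF tendsto_const tendsto_mult_left_zero[OF ratio_tendsto_0]] by fastforce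
  have s_pos: "s n > 0" for n
    unfolding s using ev g_nonneg[OF xK] by (simp add: add_pos_nonneg)
  have "(\<lambda>n. (1 / s n) *\<^sub>R (S ^^ n) x) \<longlonglongrightarrow> a"
    unfolding tendsto_iff s_def using uniform_dynamics[of "{x}"] xK fx by auto
  from tendsto_scaleR[OF s_lim this]
  have 1: "(\<lambda>n. (S ^^ n) x) \<longlonglongrightarrow> a" using s_pos by (simp add: less_imp_neq[THEN not_sym])
  have "(\<lambda>n. (S ^^ n) x - a - (\<beta> / \<alpha>) ^ n *\<^sub>R b) \<longlonglongrightarrow> a - a - 0 *\<^sub>R b"
    by (intro tendsto_intros 1 ratio_tendsto_0)
  moreover have "(S ^^ n) x - a - (\<beta> / \<alpha>) ^ n *\<^sub>R b = t *\<^sub>R (S ^^ n) v" for n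
    by (simp add: x_def linear_add[OF linear_S_pow] linear_scale[OF linear_S_pow] S_a S_b)
  ultimately have "(\<lambda>n. t *\<^sub>R (S ^^ n) v) \<longlonglongrightarrow> 0" by simp
  from tendsto_scaleR[OF tendsto_const[of "1 / t"] this] show ?thesis using t by simp
qed

text \<open>The component of \<open>v\<close> in the kernel of \<open>f\<close> is fixed by
  \<open>S\<close> and at the same time contracted to zero.\<close>

lemma eigenspace:
  assumes "A *v v = \<alpha> *\<^sub>R v"
  shows "v = (f \<bullet> v) *\<^sub>R a"
proof -
  let ?u = "v - (f \<bullet> v) *\<^sub>R a"
  have "S ?u = ?u"
    using assms A_a ev by (simp add: S_def matrix_vector_mult_diff_distrib matrix_vector_mult_scaleR scaleR_diff_right)
  then have "(S ^^ n) ?u = ?u" for n by (induction n) auto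
  moreover have "(\<lambda>n. (S ^^ n) ?u) \<longlonglongrightarrow> 0"
    by (rule kernel_contracted) (simp add: inner_diff_right f_a)
  ultimately have "?u = 0" by (simp add: LIMSEQ_const_iff)
  then show ?thesis by simp
qed

end

section \<open>Extremal eigenvalues of the lift\<close>

lemma eigenvalue_of_real:
  assumes "A *v v = r *\<^sub>R v" "v \<noteq> 0"
  shows "eigenvalue A (complex_of_real r)"
proof -
  have "complex_vec v \<noteq> 0" using assms(2) by (auto simp: complex_vec_def vec_eq_iff)
  moreover have "complexify A *v complex_vec v = complex_of_real r *s complex_vec v"
    unfolding complexify_mult assms(1) by (simp add: complex_vec_def vec_eq_iff)
  ultimately show ?thesis unfolding eigenvalue_def by blast
qed

lemma eigenvalue_inverse:
  assumes BA: "\<And>x. B *v (A *v x) = x" and "eigenvalue A m"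
  shows "m \<noteq> 0" "eigenvalue B (1 / m)"
proof -
  obtain v where v: "v \<noteq> 0" "complexify A *v v = m *s v" using assms(2) unfolding eigenvalue_def by blast
  have BAv: "complexify B *v (complexify A *v v) = v"
  proof -
    obtain x y where "v = complex_vec x + \<i> *s complex_vec y" using complex_vec_parts by blast
    then show ?thesis by (simp add: complexify_mult_parts BA)
  qed
  then show "m \<noteq> 0" using v by auto
  have "m *s (complexify B *v v) = v" using BAv by (simp add: v(2) vector_scalar_commute)
  moreover have "complexify B *v v = (1 / m) *s (m *s (complexify B *v v))"
    using \<open>m \<noteq> 0\<close> by (simp add: vec_eq_iff)
  ultimately have "complexify B *v v = (1 / m) *s v" by simp
  then show "eigenvalue B (1 / m)" unfolding eigenvalue_def using v(1) by blast
qed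

context cone_axis_dual
begin

text \<open>An eigenvector for another eigenvalue is in the kernel of \<open>f\<close>, which \<open>S\<close> contracts.\<close>

lemma eigenvalue_less:
  assumes "eigenvalue A m" "m \<noteq> complex_of_real \<alpha>"
  shows "cmod m < \<alpha>"
proof (rule ccontr)
  assume "\<not> cmod m < \<alpha>"
  then have m: "1 \<le> cmod (m / \<alpha>)" using ev by (simp add: norm_divide)
  obtain v where v: "v \<noteq> 0" "complexify A *v v = m *s v" using assms(1) unfolding eigenvalue_def by blast
  obtain x y where xy: "v = complex_vec x + \<i> *s complex_vec y" using complex_vec_parts by blast
  \<comment> \<open>\<open>F\<close> is the complex linear extension of \<open>f\<close>. It is
    multiplied by \<alpha> under \<open>A\<close>, so it vanishes on eigenvectors for any other
    eigenvalue.\<close>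
  define F where "F u = (\<Sum>j\<in>UNIV. complex_of_real (f $ j) * u $ j)" for u :: "complex ^ 'n"
  have "F (complexify A *v v) = \<alpha> * F v"
    unfolding F_def xy complexify_mult_parts sum_complex_vec_parts f_A by (simp add: distrib_left)
  moreover have "F (m *s v) = m * F v" by (simp add: F_def sum_distrib_left mult.left_commute)
  ultimately have "F v = 0" using v(2) assms(2) by simp
  then have "f \<bullet> x = 0" "f \<bullet> y = 0"
    unfolding F_def xy sum_complex_vec_parts by (auto simp: complex_eq_iff)
  then have lim: "(\<lambda>n. (S ^^ n) x) \<longlonglongrightarrow> 0" "(\<lambda>n. (S ^^ n) y) \<longlonglongrightarrow> 0" by (auto intro: kernel_contracted)
  have pow: "complex_vec ((S ^^ n) x) + \<i> *s complex_vec ((S ^^ n) y) = (m / \<alpha>) ^ n *s v" for n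
  proof (induction n)
    case (Suc n)
    have "complex_vec ((S ^^ Suc n) x) + \<i> *s complex_vec ((S ^^ Suc n) y)
        = (1 / complex_of_real \<alpha>) *s (complexify A *v (complex_vec ((S ^^ n) x) + \<i> *s complex_vec ((S ^^ n) y)))"
      unfolding complexify_mult_parts by (simp add: S_def complex_vec_def vec_eq_iff distrib_left)
    also have "\<dots> = (m / \<alpha>) ^ Suc n *s v" unfolding Suc vector_scalar_commute v(2) by (simp add: mult.commute)
    finally show ?case .
  qed (simp add: xy)
  \<comment> \<open>In this coordinate the orbit never gets smaller than \<open>v $ i\<close> in
    modulus, although contraction sends it to zero.\<close>
  obtain i where i: "v $ i \<noteq> 0" using v(1) by (auto simp: vec_eq_iff)
  have "(\<lambda>n. cmod (complex_of_real ((S ^^ n) x $ i) + \<i> * complex_of_real ((S ^^ n) y $ i)))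
      \<longlonglongrightarrow> cmod (complex_of_real (0 $ i) + \<i> * complex_of_real (0 $ i))"
    by (intro tendsto_intros lim)
  moreover have "cmod (v $ i) \<le> cmod (complex_of_real ((S ^^ n) x $ i) + \<i> * complex_of_real ((S ^^ n) y $ i))" for n
  proof -
    have "complex_of_real ((S ^^ n) x $ i) + \<i> * complex_of_real ((S ^^ n) y $ i) = (m / \<alpha>) ^ n * v $ i"
      using arg_cong[OF pow[of n], of "\<lambda>u. u $ i"] by (simp add: complex_vec_def)
    then show ?thesis using one_le_power[OF m, of n] mult_right_mono[of 1 _ "cmod (v $ i)"]
      by (simp add: norm_mult norm_power)
  qed
  ultimately have "cmod (v $ i) \<le> 0" using LIMSEQ_le_const by fastforce
  then show False using i by simp
qed

lemma max_eigenvalue: "max_eigenvalue A (complex_of_real \<alpha>)"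
  unfolding max_eigenvalue_def
proof (intro conjI allI impI)
  show "eigenvalue A (complex_of_real \<alpha>)" using eigenvalue_of_real[OF A_a a_nz] .
  show "order (complex_of_real \<alpha>) (char_poly A) = 1"
    using ev by (intro order_char_poly_eq_1[OF A_a f_A f_a _ eigenspace]) auto
  show "cmod m < cmod (complex_of_real \<alpha>)" if "eigenvalue A m \<and> m \<noteq> complex_of_real \<alpha>" for m
    using eigenvalue_less[of m] that by simp
qed

lemma eigenspace_dual:
  assumes "A *v v = \<beta> *\<^sub>R v"
  shows "v = (g \<bullet> v) *\<^sub>R b"
proof (rule cone_axis_dual.eigenspace[OF dual_pair])
  have "v = \<beta> *\<^sub>R (B *v v)" using BA[of v] by (simp add: assms matrix_vector_mult_scaleR)
  then show "B *v v = (1 / \<beta>) *\<^sub>R v" using ev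
    by (metis divideR_right inverse_eq_divide less_irrefl)
qed

text \<open>The comparison of moduli is the one for the inverse, read through
  \<open>m \<mapsto> 1 / m\<close>. Multiplicity one comes directly from the left and right
  eigenvectors \<open>g\<close> and \<open>b\<close> of \<open>A\<close>.\<close>

lemma min_eigenvalue: "min_eigenvalue A (complex_of_real \<beta>)"
  unfolding min_eigenvalue_def
proof (intro conjI allI impI)
  interpret d: cone_axis_dual C K w b a B A "1 / \<beta>" "1 / \<alpha>" g f by (rule dual_pair)
  show "eigenvalue A (complex_of_real \<beta>)" using eigenvalue_of_real[OF A_b b_nz] .
  show "order (complex_of_real \<beta>) (char_poly A) = 1"
    using ev by (intro order_char_poly_eq_1[OF A_b g_A g_b _ eigenspace_dual]) auto
  show "cmod (complex_of_real \<beta>) < cmod m" if "eigenvalue A m \<and> m \<noteq> complex_of_real \<beta>" for m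
  proof -
    have m: "m \<noteq> 0" "eigenvalue B (1 / m)" using eigenvalue_inverse[OF BA] that by auto
    moreover have "1 / m \<noteq> complex_of_real (1 / \<beta>)" using that m(1) ev by (auto simp: field_simps)
    ultimately have "cmod (1 / m) < 1 / \<beta>" using d.eigenvalue_less by blast
    then show ?thesis using m(1) ev by (simp add: norm_divide field_simps)
  qed
qed

end

section \<open>Lifts of projective maps and their extremal eigenlines\<close>

lemma line_proj_map:
  fixes A :: "real ^ 'n::finite ^ 'n"
  assumes "invertible A"
  shows "line (proj_map A p) = (\<lambda>v. A *v v) ` line p"
proof -
  have inj: "inj ((*v) A)" using assms by (simp add: inj_matrix_vector_mult)
  have "subspace ((*v) A ` line p)" "dim ((*v) A ` line p) = 1"
    using line[of p] inj by (auto simp: linear_subspace_image dim_image_eq inj_on_subset)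
  then show ?thesis unfolding proj_map_def by (intro Abs_proj_inverse) simp
qed

lemma proj_map_proj_point:
  assumes "invertible A" "v \<noteq> 0"
  shows "proj_map A (proj_point v) = proj_point (A *v v)"
proof -
  have "A *v v \<in> line (proj_map A (proj_point v))"
    by (auto simp: line_proj_map assms line_proj_point span_base)
  moreover have "A *v v \<noteq> 0" using assms by (metis invertible_left_inverse matrix_left_invertible_ker)
  ultimately show ?thesis using proj_point_line by fastforce
qed

lemma proj_point_eq_iff:
  assumes "u \<noteq> 0" "v \<noteq> 0"
  shows "proj_point u = proj_point v \<longleftrightarrow> (\<exists>c. u = c *\<^sub>R v)"
proof
  assume "proj_point u = proj_point v"
  then have "u \<in> span {v}" using assms line_proj_point span_base by (metis singletonI)
  then show "\<exists>c. u = c *\<^sub>R v" by (auto simp: span_singleton)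
next
  assume "\<exists>c. u = c *\<^sub>R v"
  then have "u \<in> line (proj_point v)" using assms by (auto simp: line_proj_point span_singleton)
  then show "proj_point u = proj_point v" using assms(1) proj_point_line by blast
qed

text \<open>Both lifts send each vector to the same line. Comparing them at \<open>u + v\<close>,
  which is nonzero by independence, forces one common factor \<open>k\<close> on the two
  eigenvectors.\<close>

lemma same_proj_map_eigenvalues:
  assumes "invertible A" "invertible A'" "proj_map A' = proj_map A" "u \<noteq> 0" "v \<noteq> 0"
    and "A *v u = \<alpha> *\<^sub>R u" and "A' *v v = r *\<^sub>R v" and "\<And>c. v \<noteq> c *\<^sub>R u"
  obtains s k where "A *v v = s *\<^sub>R v" "A' *v u = (k * \<alpha>) *\<^sub>R u" "r = k * s" 
proof -
  have par: "\<exists>c. A' *v x = c *\<^sub>R (A *v x)" "\<exists>c. A *v x = c *\<^sub>R (A' *v x)" if "x \<noteq> 0" for x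
  proof -
    have nz: "A' *v x \<noteq> 0" "A *v x \<noteq> 0" using assms(1,2) that
      by (metis invertible_left_inverse matrix_left_invertible_ker)+
    have "proj_point (A' *v x) = proj_point (A *v x)"
      using assms(1-3) that by (metis proj_map_proj_point)
    then show "\<exists>c. A' *v x = c *\<^sub>R (A *v x)" "\<exists>c. A *v x = c *\<^sub>R (A' *v x)"
      using nz proj_point_eq_iff by metis+
  qed
  obtain s where s: "A *v v = s *\<^sub>R v" using par(2)[OF assms(5)] assms(7) by auto
  obtain q where q: "A' *v u = q *\<^sub>R u" using par(1)[OF assms(4)] assms(6) by auto
  have "u + v \<noteq> 0" using assms(8)[of "-1"] by (auto simp: add_eq_0_iff)
  then obtain k where "A' *v (u + v) = k *\<^sub>R (A *v (u + v))" using par(1) by blast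
  then have eq: "q *\<^sub>R u + r *\<^sub>R v = k *\<^sub>R (\<alpha> *\<^sub>R u + s *\<^sub>R v)"
    by (simp add: matrix_vector_right_distrib assms(6,7) s q)
  then have eq': "(r - k * s) *\<^sub>R v = (k * \<alpha> - q) *\<^sub>R u" by (simp add: algebra_simps)
  have "r = k * s"
  proof (rule ccontr)
    assume "r \<noteq> k * s"
    then have "v = (1 / (r - k * s)) *\<^sub>R ((r - k * s) *\<^sub>R v)" by simp
    then have "v = ((k * \<alpha> - q) / (r - k * s)) *\<^sub>R u" unfolding eq' by simp
    then show False using assms(8) by blast
  qed
  moreover from this have "q = k * \<alpha>" using eq' assms(4) by simp
  ultimately show ?thesis using that s q by blast
qed

context cone_axis_dual
begin

lemma invertible_A: "invertible A"
proof -
  have "A *v x = 0 \<Longrightarrow> x = 0" for x using BA[of x] by simp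
  then show ?thesis by (simp add: invertible_left_inverse matrix_left_invertible_ker)
qed

text \<open>The definite description ranges over all lifts, so another lift \<open>A'\<close> must
  yield the same line. If its dominant eigenvector were not along \<open>a\<close>, the
  corresponding eigenvalue of \<open>A\<close> would be smaller than \<alpha> in modulus;
  transferring back, \<open>a\<close> would belong to an eigenvalue of \<open>A'\<close> at least as
  large as \<open>r\<close>, hence equal to \<open>r\<close>, which puts \<open>a\<close> on the
  line after all.\<close>

lemma attracting_point_eq:
  assumes "\<gamma> = proj_map A"
  shows "attracting_point \<gamma> = proj_point a"
  unfolding attracting_point_def
proof (rule the_equality)
  have "{v. A *v v = \<alpha> *\<^sub>R v} = span {a}"
    using eigenspace by (auto simp: span_singleton A_a matrix_vector_mult_scaleR)
  then show "\<exists>A r. lift_of A \<gamma> \<and> max_eigenvalue A (complex_of_real r) \<and> line (proj_point a) = {v. A *v v = r *\<^sub>R v}"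
    using max_eigenvalue invertible_A assms a_nz line_proj_point unfolding lift_of_def by metis
next
  fix p assume "\<exists>A r. lift_of A \<gamma> \<and> max_eigenvalue A (complex_of_real r) \<and> line p = {v. A *v v = r *\<^sub>R v}"
  then obtain A' r where A': "invertible A'" "proj_map A' = proj_map A" "max_eigenvalue A' (complex_of_real r)"
    "line p = {v. A' *v v = r *\<^sub>R v}" using assms unfolding lift_of_def by auto
  define v where "v = unit_rep p"
  have v: "v \<in> line p" "v \<noteq> 0" using unit_rep[of p] by (auto simp: v_def)
  have "\<exists>c. v = c *\<^sub>R a"
  proof (rule ccontr)
    assume nex: "\<nexists>c. v = c *\<^sub>R a"
    obtain s k where sk: "A *v v = s *\<^sub>R v" "A' *v a = (k * \<alpha>) *\<^sub>R a" "r = k * s"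
      using same_proj_map_eigenvalues[OF invertible_A A'(1,2) a_nz v(2) A_a, of r] v(1) A'(4) nex by auto
    have "s \<noteq> \<alpha>" using eigenspace[of v] sk(1) nex by blast
    then have "\<bar>s\<bar> < \<alpha>" using eigenvalue_less[OF eigenvalue_of_real[OF sk(1) v(2)]] by simp
    then have le: "\<bar>r\<bar> \<le> \<bar>k * \<alpha>\<bar>" using ev unfolding sk(3) abs_mult by (intro mult_left_mono) auto
    have "k * \<alpha> = r"
      using A'(3) eigenvalue_of_real[OF sk(2) a_nz] le unfolding max_eigenvalue_def
      by (metis norm_of_real not_less of_real_eq_iff)
    then have "a \<in> line p" using A'(4) sk(2) by simp
    then have "v \<in> span {a}" using v(1) line_eq_span a_nz by metis
    then show False using nex by (auto simp: span_singleton)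
  qed
  then show "p = proj_point a" using v a_nz proj_point_eq_iff proj_point_line by metis
qed

lemma repelling_point_eq:
  assumes "\<gamma> = proj_map A"
  shows "repelling_point \<gamma> = proj_point b"
  unfolding repelling_point_def
proof (rule the_equality)
  have "{v. A *v v = \<beta> *\<^sub>R v} = span {b}"
    using eigenspace_dual by (auto simp: span_singleton A_b matrix_vector_mult_scaleR)
  then show "\<exists>A r. lift_of A \<gamma> \<and> min_eigenvalue A (complex_of_real r) \<and> line (proj_point b) = {v. A *v v = r *\<^sub>R v}"
    using min_eigenvalue invertible_A assms b_nz line_proj_point unfolding lift_of_def by metis
  fix p assume "\<exists>A r. lift_of A \<gamma> \<and> min_eigenvalue A (complex_of_real r) \<and> line p = {v. A *v v = r *\<^sub>R v}"
  then obtain A' r where A': "invertible A'" "proj_map A' = proj_map A" "min_eigenvalue A' (complex_of_real r)"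
    "line p = {v. A' *v v = r *\<^sub>R v}" using assms unfolding lift_of_def by auto
  define v where "v = unit_rep p"
  have v: "v \<in> line p" "v \<noteq> 0" using unit_rep[of p] by (auto simp: v_def)
  have "\<exists>c. v = c *\<^sub>R b"
  proof (rule ccontr)
    assume nex: "\<nexists>c. v = c *\<^sub>R b"
    obtain s k where sk: "A *v v = s *\<^sub>R v" "A' *v b = (k * \<beta>) *\<^sub>R b" "r = k * s"
      using same_proj_map_eigenvalues[OF invertible_A A'(1,2) b_nz v(2) A_b, of r] v(1) A'(4) nex by auto
    have "s \<noteq> \<beta>" using eigenspace_dual[of v] sk(1) nex by blast
    then have "\<beta> < \<bar>s\<bar>"
      using min_eigenvalue eigenvalue_of_real[OF sk(1) v(2)] ev unfolding min_eigenvalue_def by fastforce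
    then have le: "\<bar>k * \<beta>\<bar> \<le> \<bar>r\<bar>" using ev unfolding sk(3) abs_mult by (intro mult_left_mono) auto
    have "k * \<beta> = r"
      using A'(3) eigenvalue_of_real[OF sk(2) b_nz] le unfolding min_eigenvalue_def
      by (metis norm_of_real not_less of_real_eq_iff)
    then have "b \<in> line p" using A'(4) sk(2) by simp
    then have "v \<in> span {b}" using v(1) line_eq_span b_nz by metis
    then show False using nex by (auto simp: span_singleton)
  qed
  then show "p = proj_point b" using v b_nz proj_point_eq_iff proj_point_line by metis
qed

end

section \<open>The cone over a convex domain\<close>

lemma proj_point_scale: "c \<noteq> 0 \<Longrightarrow> v \<noteq> 0 \<Longrightarrow> proj_point (c *\<^sub>R v) = proj_point v"
  by (subst proj_point_eq_iff) auto

lemma continuous_on_proj_point: "continuous_on (- {0}) (proj_point :: real ^ 'n::finite \<Rightarrow> 'n proj)"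
proof -
  have "open (proj_point -` U \<inter> - {0 :: real ^ 'n})" if "open U" for U :: "'n proj set"
  proof -
    have "proj_point -` U \<inter> - {0} = {v :: real ^ 'n. v \<noteq> 0 \<and> proj_point v \<in> U}" by auto
    then show ?thesis using that open_proj_iff[of U] by simp
  qed
  then show ?thesis unfolding continuous_on_open_vimage[OF open_Compl[OF closed_singleton]] by (intro allI impI)
qed

text \<open>The cone over the image is the union of all nonzero rescalings of \<open>N\<close>, each
  of which is open.\<close>

lemma open_proj_point_image:
  fixes N :: "(real ^ 'n::finite) set"
  assumes "open N" "0 \<notin> N"
  shows "open (proj_point ` N)"
proof -
  have "{v. v \<noteq> 0 \<and> proj_point v \<in> proj_point ` N} = (\<Union>c\<in>- {0}. (*\<^sub>R) c ` N)"
  proof (intro set_eqI iffI)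
    fix v assume "v \<in> {v. v \<noteq> 0 \<and> proj_point v \<in> proj_point ` N}"
    then obtain u where u: "v \<noteq> 0" "u \<in> N" "proj_point v = proj_point u" by blast
    then obtain c where "v = c *\<^sub>R u" using proj_point_eq_iff assms(2) by metis
    then show "v \<in> (\<Union>c\<in>- {0}. (*\<^sub>R) c ` N)" using u by auto
  next
    fix v assume "v \<in> (\<Union>c\<in>- {0}. (*\<^sub>R) c ` N)"
    then obtain c u where "c \<noteq> 0" "u \<in> N" "v = c *\<^sub>R u" by auto
    moreover from this have "u \<noteq> 0" using assms(2) by auto
    ultimately show "v \<in> {v. v \<noteq> 0 \<and> proj_point v \<in> proj_point ` N}" by (auto simp: proj_point_scale)
  qed
  moreover have "open (\<Union>c\<in>- {0::real}. (*\<^sub>R) c ` N)" using assms(1) by (auto intro: open_scaling)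
  ultimately show ?thesis by (simp add: open_proj_iff)
qed

lemma coord:
  assumes "p \<in> chart w"
  shows "coord w p \<in> line p" "w \<bullet> coord w p = 1" "coord w p \<noteq> 0" "proj_point (coord w p) = p"
proof -
  obtain x where x: "x \<in> line p" "w \<bullet> x = 1" using assms unfolding chart_def by blast
  then have x0: "x \<noteq> 0" by auto
  have uniq: "y = x" if "y \<in> line p \<and> w \<bullet> y = 1" for y
  proof -
    have "y \<in> span {x}" using that line_eq_span[OF x(1) x0] by blast
    then obtain c where "y = c *\<^sub>R x" by (auto simp: span_singleton)
    then show ?thesis using that x by auto
  qed
  have "coord w p = x" unfolding coord_def by (rule the_equality[OF _ uniq]) (use x in auto)
  then show "coord w p \<in> line p" "w \<bullet> coord w p = 1" "coord w p \<noteq> 0" "proj_point (coord w p) = p"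
    using x x0 proj_point_line by auto
qed

lemma chart_proj_point:
  assumes "v \<noteq> 0"
  shows "proj_point v \<in> chart w \<longleftrightarrow> w \<bullet> v \<noteq> 0"
proof
  assume "w \<bullet> v \<noteq> 0"
  then have "w \<bullet> ((1 / (w \<bullet> v)) *\<^sub>R v) = 1" "(1 / (w \<bullet> v)) *\<^sub>R v \<in> line (proj_point v)"
    using assms by (auto simp: line_proj_point span_singleton)
  then show "proj_point v \<in> chart w" unfolding chart_def by blast
qed (use assms in \<open>auto simp: chart_def line_proj_point span_singleton\<close>)

lemma coord_proj_point:
  assumes "w \<bullet> v \<noteq> 0"
  shows "coord w (proj_point v) = (1 / (w \<bullet> v)) *\<^sub>R v"
proof -
  have v: "v \<noteq> 0" using assms by auto
  then have c: "proj_point v \<in> chart w" using chart_proj_point assms by blast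
  then obtain t where t: "coord w (proj_point v) = t *\<^sub>R v"
    using coord(1)[OF c] by (auto simp: line_proj_point[OF v] span_singleton)
  then have "t * (w \<bullet> v) = 1" using coord(2)[OF c] by simp
  then have "t = 1 / (w \<bullet> v)" using assms by (simp add: field_simps)
  then show ?thesis using t by simp
qed

text \<open>The last assumption ties \<open>w\<close> to the chart in which segments and the Hilbert
  metric are computed, so \<open>coord w\<close> can stand for \<open>aff\<close>.\<close>

locale convex_domain =
  fixes \<Omega> :: "'n::finite proj set" and w :: "real ^ 'n"
  assumes nonempty: "\<Omega> \<noteq> {}" and open_domain: "open \<Omega>" and chart: "convex_chart \<Omega> w"
    and aff: "aff \<Omega> = coord w"
begin

text \<open>The vectors over the domain form two opposite cones; the sign of \<open>w\<close>
  selects one of them.\<close>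

definition C :: "(real ^ 'n) set" where "C = {v. v \<noteq> 0 \<and> 0 < w \<bullet> v \<and> proj_point v \<in> \<Omega>}"

definition K :: "(real ^ 'n) set" where "K = closure C"

lemma domain_chart: "p \<in> closure \<Omega> \<Longrightarrow> p \<in> chart w" "p \<in> \<Omega> \<Longrightarrow> p \<in> chart w"
  using chart closure_subset[of \<Omega>] unfolding convex_chart_def by blast+

lemma C_iff: "v \<in> C \<longleftrightarrow> 0 < w \<bullet> v \<and> (1 / (w \<bullet> v)) *\<^sub>R v \<in> coord w ` \<Omega>"
proof
  assume "v \<in> C"
  then show "0 < w \<bullet> v \<and> (1 / (w \<bullet> v)) *\<^sub>R v \<in> coord w ` \<Omega>"
    using coord_proj_point[of w v] by (auto simp: C_def intro!: image_eqI)
next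
  assume *: "0 < w \<bullet> v \<and> (1 / (w \<bullet> v)) *\<^sub>R v \<in> coord w ` \<Omega>"
  then obtain p where p: "p \<in> \<Omega>" "(1 / (w \<bullet> v)) *\<^sub>R v = coord w p" by auto
  have "v \<noteq> 0" using * by auto
  then have "proj_point v = p" using p coord(4)[OF domain_chart(2)[OF p(1)]] * proj_point_scale[of "1 / (w \<bullet> v)" v]
    by auto
  then show "v \<in> C" using p * \<open>v \<noteq> 0\<close> by (auto simp: C_def)
qed

lemma open_C: "open C"
proof -
  have "C = {v. v \<noteq> 0 \<and> proj_point v \<in> \<Omega>} \<inter> {v. 0 < w \<bullet> v}" by (auto simp: C_def)
  then show ?thesis using open_domain open_proj_iff open_halfspace_gt[of 0 w] by (auto intro: open_Int)
qed

lemma C_scale: "v \<in> C \<Longrightarrow> 0 < c \<Longrightarrow> c *\<^sub>R v \<in> C"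
  by (auto simp: C_def proj_point_scale)

text \<open>Rescaled to the chart, \<open>u + v\<close> is the average of the rescaled
  \<open>u\<close> and \<open>v\<close> with weights proportional to \<open>w \<bullet> u\<close>
  and \<open>w \<bullet> v\<close>.\<close>

lemma C_add:
  assumes "u \<in> C" "v \<in> C"
  shows "u + v \<in> C"
proof -
  let ?a = "w \<bullet> u" and ?b = "w \<bullet> v"
  have pos: "0 < ?a" "0 < ?b" using assms by (auto simp: C_iff)
  have "(?a / (?a + ?b)) *\<^sub>R ((1 / ?a) *\<^sub>R u) + (?b / (?a + ?b)) *\<^sub>R ((1 / ?b) *\<^sub>R v) \<in> coord w ` \<Omega>"
    using assms chart pos unfolding convex_chart_def
    by (intro convexD) (auto simp: C_iff add_divide_distrib[symmetric])
  then show ?thesis using pos by (simp add: C_iff inner_add_right scaleR_add_right)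
qed

lemma convex_C: "convex C"
  unfolding convex_def
proof (intro ballI allI impI)
  fix x y and s t :: real
  assume "x \<in> C" "y \<in> C" "0 \<le> s" "0 \<le> t" "s + t = 1"
  then show "s *\<^sub>R x + t *\<^sub>R y \<in> C"
    using C_add[of "s *\<^sub>R x" "t *\<^sub>R y"] C_scale by (cases "s = 0"; cases "t = 0") auto
qed

lemma C_nonempty: "C \<noteq> {}"
proof -
  obtain p where p: "p \<in> \<Omega>" using nonempty by blast
  then have "coord w p \<in> C" using coord[OF domain_chart(2)[OF p]] by (simp add: C_def)
  then show ?thesis by blast
qed

lemma C_sub_K: "C \<subseteq> K" and closed_K: "closed K"
  by (simp_all add: K_def closure_subset)

lemma zero_K: "0 \<in> K"
proof -
  obtain x where x: "x \<in> C" using C_nonempty by blast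
  have "(\<lambda>n. (1 / real (Suc n)) *\<^sub>R x) \<longlonglongrightarrow> 0 *\<^sub>R x"
    by (intro tendsto_intros LIMSEQ_Suc[OF lim_1_over_n])
  moreover have "(1 / real (Suc n)) *\<^sub>R x \<in> K" for n using C_scale[OF x] C_sub_K by auto
  ultimately show ?thesis using closed_sequentially[OF closed_K, of "\<lambda>n. (1 / real (Suc n)) *\<^sub>R x"] by auto
qed

lemma K_scale:
  assumes "x \<in> K" "0 \<le> c"
  shows "c *\<^sub>R x \<in> K"
proof (cases "c = 0")
  case False
  have "c *\<^sub>R x \<in> (*\<^sub>R) c ` closure C" using assms unfolding K_def by blast
  also have "\<dots> = closure ((*\<^sub>R) c ` C)" by (rule closure_scaleR)
  also have "\<dots> \<subseteq> K" unfolding K_def using False assms(2) by (intro closure_mono) (auto intro: C_scale)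
  finally show ?thesis .
qed (simp add: zero_K)

lemma K_add:
  assumes "x \<in> K" "y \<in> K"
  shows "x + y \<in> K"
proof -
  have "(1/2) *\<^sub>R x + (1/2) *\<^sub>R y \<in> K"
    using convex_closure[OF convex_C] assms unfolding K_def by (intro convexD) auto
  from K_scale[OF this, of 2] show ?thesis by (simp add: scaleR_add_right)
qed

text \<open>Replace \<open>y\<close> by a nearby point of \<open>C\<close>; the error is absorbed by
  a ball around \<open>x\<close>.\<close>

lemma C_K_add:
  assumes "x \<in> C" "y \<in> K"
  shows "x + y \<in> C"
proof -
  obtain e where e: "e > 0" "ball x e \<subseteq> C" using open_C assms(1) open_contains_ball by blast
  obtain y' where y': "y' \<in> C" "dist y' y < e" using assms(2) e(1) unfolding K_def closure_approachable by blast
  then have "x + (y - y') \<in> C" using e(2) by (auto simp: dist_norm norm_minus_commute)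
  from C_add[OF this y'(1)] show ?thesis by simp
qed

text \<open>Boundedness in the chart, written homogeneously so that it survives the closure. It is
  what makes \<open>w\<close> positive on nonzero vectors of \<open>K\<close>.\<close>

lemma K_bound:
  obtains R where "\<And>v. v \<in> K \<Longrightarrow> norm v \<le> R * (w \<bullet> v)"
proof -
  obtain R where R: "\<And>x. x \<in> coord w ` \<Omega> \<Longrightarrow> norm x \<le> R"
    using chart unfolding convex_chart_def bounded_iff by blast
  have "C \<subseteq> {v. norm v \<le> R * (w \<bullet> v)}"
  proof
    fix v assume "v \<in> C"
    then have "0 < w \<bullet> v" "norm ((1 / (w \<bullet> v)) *\<^sub>R v) \<le> R" using R C_iff by blast+
    then show "v \<in> {v. norm v \<le> R * (w \<bullet> v)}" by (simp add: field_simps)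
  qed
  moreover have "closed {v. norm v \<le> R * (w \<bullet> v)}" by (intro closed_Collect_le continuous_intros)
  ultimately have "K \<subseteq> {v. norm v \<le> R * (w \<bullet> v)}" unfolding K_def by (rule closure_minimal)
  then show ?thesis using that by blast
qed

lemma w_nonneg: "v \<in> K \<Longrightarrow> 0 \<le> w \<bullet> v"
proof -
  assume "v \<in> K"
  moreover have "C \<subseteq> {v. 0 \<le> w \<bullet> v}" by (auto simp: C_def)
  then have "K \<subseteq> {v. 0 \<le> w \<bullet> v}" unfolding K_def
    by (rule closure_minimal) (intro closed_Collect_le continuous_intros)
  ultimately show ?thesis by blast
qed

lemma w_pos:
  assumes "v \<in> K" "v \<noteq> 0"
  shows "0 < w \<bullet> v"
proof -
  obtain R where "norm v \<le> R * (w \<bullet> v)" using K_bound assms(1) by metis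
  then have "w \<bullet> v \<noteq> 0" using assms(2) by auto
  then show ?thesis using w_nonneg[OF assms(1)] by simp
qed

lemma C_iff': "0 < w \<bullet> v \<Longrightarrow> v \<in> C \<longleftrightarrow> proj_point v \<in> \<Omega>"
  by (auto simp: C_def)

lemma K_iff:
  assumes "0 < w \<bullet> v"
  shows "v \<in> K \<longleftrightarrow> proj_point v \<in> closure \<Omega>"
proof
  have v0: "v \<noteq> 0" using assms by auto
  {
    assume v: "v \<in> K"
    show "proj_point v \<in> closure \<Omega>"
      unfolding closure_iff_nhds_not_empty
    proof (intro allI impI)
      fix A U assume U: "U \<subseteq> A" "open U" "proj_point v \<in> U"
      have "open {u. u \<noteq> 0 \<and> proj_point u \<in> U}" using U(2) open_proj_iff by blast
      then obtain u where "u \<in> C" "u \<noteq> 0" "proj_point u \<in> U"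
        using v U(3) v0 unfolding K_def closure_iff_nhds_not_empty by blast
      then show "\<Omega> \<inter> A \<noteq> {}" using U(1) by (auto simp: C_def)
    qed
  next
    assume p: "proj_point v \<in> closure \<Omega>"
    show "v \<in> K"
      unfolding K_def closure_iff_nhds_not_empty
    proof (intro allI impI)
      fix A N assume N: "N \<subseteq> A" "open N" "v \<in> N"
      \<comment> \<open>Cutting with the half space ensures that a vector over the domain lies in
        \<open>C\<close> and not in the opposite cone.\<close>
      define N' where "N' = N \<inter> {u. 0 < w \<bullet> u}"
      have "open N'" unfolding N'_def using N(2) open_halfspace_gt[of 0 w] by auto
      then have "open (proj_point ` N')" by (intro open_proj_point_image) (auto simp: N'_def)
      moreover have "proj_point v \<in> proj_point ` N'" using N(3) assms by (auto simp: N'_def)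
      ultimately obtain u where "u \<in> N'" "proj_point u \<in> \<Omega>"
        using p unfolding closure_iff_nhds_not_empty by blast
      then have "u \<in> C \<inter> A" using N(1) by (auto simp: N'_def C_def)
      then show "C \<inter> A \<noteq> {}" by blast
    qed
  }
qed

lemma coord_K: "p \<in> closure \<Omega> \<Longrightarrow> coord w p \<in> K"
  using K_iff[of "coord w p"] coord[OF domain_chart(1)] by simp

lemma coord_C: "p \<in> \<Omega> \<Longrightarrow> coord w p \<in> C"
  using C_iff'[of "coord w p"] coord[OF domain_chart(2)] by simp

lemma coord_frontier: "p \<in> frontier \<Omega> \<Longrightarrow> coord w p \<in> K \<and> coord w p \<notin> C"
  using coord_K C_iff'[of "coord w p"] coord[OF domain_chart(1)] open_domain
  by (auto simp: frontier_def interior_open)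

lemma frontier_proj_point:
  assumes "z \<in> K" "z \<noteq> 0" "z \<notin> C"
  shows "proj_point z \<in> frontier \<Omega>"
  using assms w_pos[OF assms(1,2)] K_iff[of z] C_iff'[of z] open_domain
  by (auto simp: frontier_def interior_open)

text \<open>A large multiple of the new combination exceeds the old one by a nonnegative combination
  of \<open>x\<close> and \<open>y\<close>, and adding elements of \<open>K\<close> does not leave
  \<open>C\<close>.\<close>

lemma combination_C:
  assumes "x \<in> K" "y \<in> K" "0 \<le> s" "0 \<le> t" "s *\<^sub>R x + t *\<^sub>R y \<in> C" "0 < s'" "0 < t'"
  shows "s' *\<^sub>R x + t' *\<^sub>R y \<in> C"
proof -
  define M where "M = (s + 1) / s' + (t + 1) / t'"
  have M: "M > 0" using assms by (simp add: M_def add_pos_pos)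
  have st: "s \<le> M * s'" "t \<le> M * t'" using assms by (simp_all add: M_def field_simps)
  have "(s *\<^sub>R x + t *\<^sub>R y) + ((M * s' - s) *\<^sub>R x + (M * t' - t) *\<^sub>R y) \<in> C"
    by (rule C_K_add[OF assms(5)]) (use assms st in \<open>auto intro!: K_add K_scale\<close>)
  then have "M *\<^sub>R (s' *\<^sub>R x + t' *\<^sub>R y) \<in> C" by (simp add: algebra_simps)
  from C_scale[OF this, of "1 / M"] show ?thesis using M by simp
qed

end

context convex_domain
begin

subsection \<open>Hilbert metric\<close>

lemma coord_inj:
  assumes "p \<in> closure \<Omega>" "q \<in> closure \<Omega>" "coord w p = coord w q"
  shows "p = q"
proof -
  have 1: "proj_point (coord w p) = p" by (rule coord(4)[OF domain_chart(1)[OF assms(1)]])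
  have 2: "proj_point (coord w q) = q" by (rule coord(4)[OF domain_chart(1)[OF assms(2)]])
  show ?thesis using 1 2 unfolding assms(3) by (rule trans[OF sym])
qed

lemma seg_eq: "seg \<Omega> p q = {r \<in> closure \<Omega>. coord w r \<in> closed_segment (coord w p) (coord w q)}"
  unfolding seg_def aff ..

lemma coord_seg:
  assumes "p \<in> closure \<Omega>" "q \<in> closure \<Omega>"
  shows "coord w ` seg \<Omega> p q = closed_segment (coord w p) (coord w q)"
proof -
  have "v \<in> coord w ` seg \<Omega> p q" if "v \<in> closed_segment (coord w p) (coord w q)" for v
  proof -
    obtain u where u: "0 \<le> u" "u \<le> 1" "v = (1 - u) *\<^sub>R coord w p + u *\<^sub>R coord w q"
      using \<open>v \<in> closed_segment (coord w p) (coord w q)\<close> unfolding in_segment by blast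
    have v: "v \<in> K" using u assms by (auto intro!: K_add K_scale coord_K)
    have w1: "w \<bullet> v = 1"
      using u(3) coord(2)[OF domain_chart(1)] assms by (simp add: inner_add_right)
    then have "coord w (proj_point v) = v" using coord_proj_point[of w v] by simp
    moreover have "proj_point v \<in> closure \<Omega>" using K_iff[of v] v w1 by simp
    ultimately have "v = coord w (proj_point v)" "proj_point v \<in> seg \<Omega> p q" using that by (auto simp: seg_eq)
    then show ?thesis by (rule image_eqI)
  qed
  then show ?thesis by (auto simp: seg_eq)
qed

text \<open>At height \<open>w = 1\<close> the coefficients of a combination of the two vectors sum
  to 1, so the projective line appears as an affine line.\<close>

lemma mem_proj_line_iff:
  assumes "x \<in> closure \<Omega>" "y \<in> closure \<Omega>" "r \<in> closure \<Omega>"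
  shows "r \<in> proj_line x y \<longleftrightarrow> (\<exists>t. coord w r = coord w x + t *\<^sub>R (coord w y - coord w x))"
proof -
  have l: "line p = span {coord w p}" if "p \<in> closure \<Omega>" for p
    using line_eq_span coord[OF domain_chart(1)[OF that]] by blast
  have sp: "span (line x \<union> line y) = span {coord w x, coord w y}"
  proof (rule subset_antisym)
    have "line x \<union> line y \<subseteq> span {coord w x, coord w y}"
      unfolding l[OF assms(1)] l[OF assms(2)] by (simp add: span_mono)
    then show "span (line x \<union> line y) \<subseteq> span {coord w x, coord w y}" by (simp add: span_minimal)
    show "span {coord w x, coord w y} \<subseteq> span (line x \<union> line y)"
      using coord(1)[OF domain_chart(1)] assms(1,2) by (intro span_mono) auto
  qed
  have "r \<in> proj_line x y \<longleftrightarrow> coord w r \<in> span {coord w x, coord w y}"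
    unfolding proj_line_def proj_space_def sp mem_Collect_eq l[OF assms(3)]
    using span_minimal[of "{coord w r}" "span {coord w x, coord w y}"] span_base[of "coord w r" "{coord w r}"]
    by auto
  also have "\<dots> \<longleftrightarrow> (\<exists>t. coord w r = coord w x + t *\<^sub>R (coord w y - coord w x))"
  proof
    assume "coord w r \<in> span {coord w x, coord w y}"
    then obtain s t where st: "coord w r = s *\<^sub>R coord w x + t *\<^sub>R coord w y"
      unfolding span_breakdown_eq[of _ _ "{coord w y}"] span_singleton by (auto simp: diff_eq_eq add.commute)
    then have "s + t = 1" using coord(2)[OF domain_chart(1)] assms by (metis inner_add_right inner_scaleR_right mult.right_neutral)
    then have "coord w r = coord w x + t *\<^sub>R (coord w y - coord w x)"
      using st by (simp add: algebra_simps flip: scaleR_add_left)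
    then show "\<exists>t. coord w r = coord w x + t *\<^sub>R (coord w y - coord w x)" ..
  next
    assume "\<exists>t. coord w r = coord w x + t *\<^sub>R (coord w y - coord w x)"
    then show "coord w r \<in> span {coord w x, coord w y}"
      by (auto intro!: span_add span_scale span_diff simp: span_base)
  qed
  finally show ?thesis .
qed

text \<open>The parameters \<open>t\<close> with \<open>P t\<close> in \<open>K\<close> form a
  compact interval; its end points give the chord. As \<open>C\<close> is open, the parameters 0 and
  1 are interior and no end lies in \<open>C\<close>.\<close>

lemma chord_ends_exist:
  assumes x: "x \<in> \<Omega>" and y: "y \<in> \<Omega>" and "x \<noteq> y"
  obtains a b where "chord_ends \<Omega> x y a b"
proof -
  let ?X = "coord w x" and ?Y = "coord w y"
  have cl: "x \<in> closure \<Omega>" "y \<in> closure \<Omega>" using x y closure_subset by auto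
  define D where "D = ?Y - ?X"
  have D: "D \<noteq> 0" using coord_inj[OF cl] assms(3) by (auto simp: D_def)
  define P where "P t = ?X + t *\<^sub>R D" for t
  have contP: "continuous_on UNIV P" unfolding P_def by (intro continuous_intros)
  have P01: "P 0 = ?X" "P 1 = ?Y" by (auto simp: P_def D_def)
  have wX: "w \<bullet> ?X = 1" "w \<bullet> ?Y = 1" using coord(2)[OF domain_chart(1)] cl by auto
  have wP: "w \<bullet> P t = 1" for t by (simp add: P_def D_def inner_add_right inner_diff_right wX)
  define T where "T = {t. P t \<in> K}"
  have "T = P -` K" by (auto simp: T_def)
  then have "closed T" using closed_vimage[OF closed_K contP] by simp
  moreover have "bounded T"
  proof -
    obtain R where R: "\<And>v. v \<in> K \<Longrightarrow> norm v \<le> R * (w \<bullet> v)" using K_bound by blast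
    have "norm t \<le> (R + norm ?X) / norm D" if "t \<in> T" for t
    proof -
      have "norm (P t) \<le> R" using R[of "P t"] that wP by (simp add: T_def)
      moreover have "norm (t *\<^sub>R D) \<le> norm (P t) + norm ?X"
        using norm_triangle_ineq4[of "P t" ?X] by (simp add: P_def)
      ultimately show ?thesis using D by (simp add: field_simps)
    qed
    then show ?thesis unfolding bounded_iff by blast
  qed
  moreover have "convex T"
    unfolding convex_def
  proof (intro ballI allI impI)
    fix s t u v :: real assume *: "s \<in> T" "t \<in> T" "0 \<le> u" "0 \<le> v" "u + v = 1"
    have "u *\<^sub>R ?X + v *\<^sub>R ?X = ?X" using *(5) by (metis scaleR_add_left scaleR_one)
    then have "P (u *\<^sub>R s + v *\<^sub>R t) = u *\<^sub>R P s + v *\<^sub>R P t" by (simp add: P_def algebra_simps)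
    then show "u *\<^sub>R s + v *\<^sub>R t \<in> T" using * by (auto simp: T_def intro!: K_add K_scale)
  qed
  ultimately obtain t0 t1 where T: "T = {t0..t1}"
    using connected_compact_interval_1[of T] convex_connected compact_eq_bounded_closed by blast
  have open_T: "\<exists>e>0. t - e \<in> T \<and> t + e \<in> T" if PtC: "P t \<in> C" for t
  proof -
    have "open (P -` C)" using open_vimage[OF open_C contP] .
    then obtain e where e: "e > 0" "cball t e \<subseteq> P -` C" 
      using \<open>open (P -` C)\<close>[unfolded open_contains_cball, rule_format, of t] PtC by auto
    then have "t - e \<in> P -` C" "t + e \<in> P -` C" by (auto simp: subset_iff dist_real_def)
    then show ?thesis using e(1) C_sub_K by (auto simp: T_def)
  qed
  have t01: "t0 < 0" "1 < t1" using open_T[of 0] open_T[of 1] coord_C x y P01 by (auto simp: T)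
  have ends: "proj_point (P t) \<in> frontier \<Omega>" if "t = t0 \<or> t = t1" for t
  proof -
    have "P t \<in> K" using that t01 T unfolding T_def by fastforce
    moreover have "P t \<notin> C" using open_T[of t] that by (auto simp: T)
    moreover have "P t \<noteq> 0" using wP[of t] by auto
    ultimately show ?thesis using frontier_proj_point by blast
  qed
  have cP: "coord w (proj_point (P t)) = P t" for t using coord_proj_point[of w "P t"] wP by simp
  have comb: "(1 - k) *\<^sub>R P s + k *\<^sub>R P t = P ((1 - k) * s + k * t)" for k s t
    by (simp add: P_def algebra_simps)
  have cs: "P u \<in> closed_segment (P s) (P t)" if "s \<le> u" "u \<le> t" for s u t
  proof (cases "s = t")
    case False
    define k where "k = (u - s) / (t - s)"
    have "k * (t - s) = u - s" using False by (simp add: k_def)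
    then have "P u = (1 - k) *\<^sub>R P s + k *\<^sub>R P t" unfolding comb by (simp add: algebra_simps)
    moreover have "0 \<le> k" "k \<le> 1" using that False by (auto simp: k_def field_simps)
    ultimately show ?thesis unfolding in_segment(1) by (intro exI[of _ k]) simp
  qed (use that in auto)
  have sc: "\<exists>u. z = P u" if z: "z \<in> closed_segment (P s) (P t)" for s t z
  proof -
    obtain k where "z = (1 - k) *\<^sub>R P s + k *\<^sub>R P t" using z unfolding in_segment(1) by auto
    then have "z = P ((1 - k) * s + k * t)" unfolding comb .
    then show ?thesis ..
  qed
  have "closure \<Omega> \<inter> proj_line x y = seg \<Omega> (proj_point (P t0)) (proj_point (P t1))"
  proof (intro set_eqI)
    fix r
    have "coord w r \<in> closed_segment (P t0) (P t1)" if r: "r \<in> closure \<Omega>" and u: "coord w r = P u" for u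
    proof -
      have "u \<in> T" using coord_K[OF r] u by (simp add: T_def)
      then show ?thesis using u cs[of t0 u t1] by (simp add: T)
    qed
    then show "r \<in> closure \<Omega> \<inter> proj_line x y \<longleftrightarrow> r \<in> seg \<Omega> (proj_point (P t0)) (proj_point (P t1))"
      using mem_proj_line_iff[OF cl, of r] sc unfolding seg_eq cP by (auto simp: P_def D_def)
  qed
  moreover have "x \<in> seg \<Omega> (proj_point (P t0)) y" "y \<in> seg \<Omega> x (proj_point (P t1))"
    using cs[of t0 0 1] cs[of 0 1 t1] t01 cl by (auto simp: seg_eq cP P01)
  ultimately have "chord_ends \<Omega> x y (proj_point (P t0)) (proj_point (P t1))"
    unfolding chord_ends_def using ends by blast
  then show ?thesis using that by blast
qed

lemma dist_closed_segment: "z \<in> closed_segment u v \<Longrightarrow> dist u v = dist u z + dist z v"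
  for u v z :: "real ^ 'n"
  unfolding between_mem_segment[symmetric] between .

text \<open>Equal segments have the same pair of ends. Swapped ends would put \<open>x\<close>
  between \<open>a\<close> and \<open>y\<close>, and \<open>y\<close> between \<open>x\<close> and
  \<open>a\<close>, forcing \<open>x = y\<close>.\<close>

lemma chord_ends_unique:
  assumes "x \<in> \<Omega>" "y \<in> \<Omega>" "x \<noteq> y" "chord_ends \<Omega> x y a b" "chord_ends \<Omega> x y a' b'"
  shows "a = a' \<and> b = b'"
proof -
  have cl: "x \<in> closure \<Omega>" "y \<in> closure \<Omega>" "a \<in> closure \<Omega>" "b \<in> closure \<Omega>" "a' \<in> closure \<Omega>" "b' \<in> closure \<Omega>"
    using assms closure_subset unfolding chord_ends_def frontier_def by auto
  have "seg \<Omega> a b = seg \<Omega> a' b'" using assms(4,5) unfolding chord_ends_def by simp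
  then have "closed_segment (coord w a) (coord w b) = closed_segment (coord w a') (coord w b')"
    using coord_seg cl by metis
  then have "{coord w a, coord w b} = {coord w a', coord w b'}" by simp
  moreover have "coord w a \<noteq> coord w b'"
  proof
    assume eq: "coord w a = coord w b'"
    have "coord w x \<in> closed_segment (coord w a) (coord w y)" "coord w y \<in> closed_segment (coord w x) (coord w a)"
      using assms(4,5) unfolding chord_ends_def seg_eq eq by auto
    from this[THEN dist_closed_segment] have "dist (coord w x) (coord w y) = 0"
      using zero_le_dist[of "coord w x" "coord w y"] by (simp add: dist_commute)
    then show False using coord_inj[OF cl(1,2)] assms(3) by simp
  qed
  ultimately have "coord w a = coord w a'" "coord w b = coord w b'" by (auto simp: doubleton_eq_iff)
  then show ?thesis using coord_inj cl by blast
qed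

text \<open>The order of the four points makes the cross-ratio at least 1. Existence and uniqueness
  of the chord are what give the definite description its value.\<close>

lemma hilbert_dist_nonneg:
  assumes "x \<in> \<Omega>" "y \<in> \<Omega>"
  shows "0 \<le> hilbert_dist \<Omega> x y"
proof (cases "x = y")
  case False
  obtain a b where ab: "chord_ends \<Omega> x y a b" using chord_ends_exist[OF assms False] by blast
  let ?r = "1 / 2 * ln ((dist (aff \<Omega> b) (aff \<Omega> x) * dist (aff \<Omega> y) (aff \<Omega> a)) /
    (dist (aff \<Omega> b) (aff \<Omega> y) * dist (aff \<Omega> x) (aff \<Omega> a)))"
  have "hilbert_dist \<Omega> x y = ?r"
    unfolding hilbert_dist_def if_not_P[OF False]
  proof (rule the_equality)
    show "\<exists>a b. chord_ends \<Omega> x y a b \<and> ?r = 1 / 2 * ln ((dist (aff \<Omega> b) (aff \<Omega> x) * dist (aff \<Omega> y) (aff \<Omega> a)) /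
      (dist (aff \<Omega> b) (aff \<Omega> y) * dist (aff \<Omega> x) (aff \<Omega> a)))"
      using ab by blast
  qed (use chord_ends_unique[OF assms False ab] in blast)
  moreover have "0 \<le> ?r"
  proof -
    have "coord w a \<notin> C" "coord w b \<notin> C" using ab coord_frontier unfolding chord_ends_def by auto
    then have ne: "coord w x \<noteq> coord w a" "coord w y \<noteq> coord w b" using coord_C assms by metis+
    have "coord w x \<in> closed_segment (coord w a) (coord w y)" "coord w y \<in> closed_segment (coord w x) (coord w b)"
      using ab unfolding chord_ends_def seg_eq by auto
    from this[THEN dist_closed_segment]
    have "dist (coord w b) (coord w y) \<le> dist (coord w b) (coord w x)"
      "dist (coord w x) (coord w a) \<le> dist (coord w y) (coord w a)"
      by (simp_all add: dist_commute)
    then have "dist (coord w b) (coord w y) * dist (coord w x) (coord w a)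
        \<le> dist (coord w b) (coord w x) * dist (coord w y) (coord w a)"
      by (intro mult_mono) auto
    moreover have "0 < dist (coord w b) (coord w y) * dist (coord w x) (coord w a)" using ne by simp
    ultimately show ?thesis unfolding aff by (simp add: le_divide_eq_1_pos)
  qed
  ultimately show ?thesis by simp
qed (simp add: hilbert_dist_def)

text \<open>Nonnegativity of the Hilbert metric is needed here: the infimum of a set of reals that is not
  bounded below is a junk value.\<close>

lemma translation_length_le_0:
  assumes "g ` \<Omega> = \<Omega>" "x \<in> \<Omega>" "g x = x"
  shows "translation_length \<Omega> g \<le> 0"
proof -
  have "bdd_below ((\<lambda>x. hilbert_dist \<Omega> x (g x)) ` \<Omega>)"
    using hilbert_dist_nonneg assms(1) by (intro bdd_belowI2[where m = 0]) blast
  then have "translation_length \<Omega> g \<le> hilbert_dist \<Omega> x (g x)"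
    unfolding translation_length_def using assms(2) by (rule cINF_lower)
  then show ?thesis using assms(3) by (simp add: hilbert_dist_def)
qed

end

section \<open>Rank one isometries\<close>

lemma invertible_mult_nonzero: "invertible A \<Longrightarrow> v \<noteq> 0 \<Longrightarrow> A *v v \<noteq> 0"
  for A :: "real ^ 'n ^ 'n"
  unfolding invertible_left_inverse matrix_left_invertible_ker by blast

lemma proj_map_uminus: "proj_map (- A) = proj_map A" for A :: "real ^ 'n::finite ^ 'n"
proof
  fix p :: "'n proj"
  have neg: "- v \<in> line p" if "v \<in> line p" for v using line[of p] that by (auto intro: subspace_neg)
  have "(*v) (- A) ` line p = (*v) A ` line p"
  proof (intro set_eqI iffI)
    fix x assume "x \<in> (*v) (- A) ` line p"
    then obtain v where "v \<in> line p" "x = (- A) *v v" by blast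
    then have "- v \<in> line p" "x = A *v (- v)"
      using neg by (auto simp: vec_eq_iff matrix_vector_mult_def)
    then show "x \<in> (*v) A ` line p" by blast
  next
    fix x assume "x \<in> (*v) A ` line p"
    then obtain v where "v \<in> line p" "x = A *v v" by blast
    then have "- v \<in> line p" "x = (- A) *v (- v)"
      using neg by (auto simp: vec_eq_iff matrix_vector_mult_def)
    then show "x \<in> (*v) (- A) ` line p" by blast
  qed
  then show "proj_map (- A) p = proj_map A p" by (simp add: proj_map_def)
qed

context convex_domain
begin

text \<open>\<open>w \<bullet> (A *v v)\<close> never vanishes on \<open>C\<close>. If it took both
  signs, a positive combination of two vectors of \<open>C\<close> would be a zero of it.\<close>

lemma lift_sign:
  assumes "invertible A" "proj_map A ` \<Omega> = \<Omega>"
  shows "(\<forall>v\<in>C. A *v v \<in> C) \<or> (\<forall>v\<in>C. (- A) *v v \<in> C)"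
proof -
  have neg: "(- A) *v v = - (A *v v)" for v by (simp add: vec_eq_iff matrix_vector_mult_def sum_negf)
  have im: "A *v v \<noteq> 0" "proj_point (A *v v) \<in> \<Omega>" if "v \<in> C" for v
  proof -
    have v: "v \<noteq> 0" "proj_point v \<in> \<Omega>" using that by (auto simp: C_def)
    show "A *v v \<noteq> 0" using invertible_mult_nonzero assms(1) v(1) by blast
    show "proj_point (A *v v) \<in> \<Omega>"
      unfolding proj_map_proj_point[OF assms(1) v(1), symmetric] using assms(2) v(2) by blast
  qed
  have nz: "w \<bullet> (A *v v) \<noteq> 0" if "v \<in> C" for v
    using chart_proj_point[OF im(1)[OF that], of w] domain_chart(2)[OF im(2)[OF that]] by blast
  have "0 < w \<bullet> (A *v v)" if u: "u \<in> C" "0 < w \<bullet> (A *v u)" and v: "v \<in> C" for u v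
  proof (rule ccontr)
    assume "\<not> 0 < w \<bullet> (A *v v)"
    then have neg: "w \<bullet> (A *v v) < 0" using nz[OF v] by linarith
    have "(- (w \<bullet> (A *v v))) *\<^sub>R u + (w \<bullet> (A *v u)) *\<^sub>R v \<in> C"
      using u v neg by (intro C_add C_scale) auto
    from nz[OF this] show False
      by (simp add: matrix_vector_mult_diff_distrib matrix_vector_mult_scaleR inner_diff_right)
  qed
  then consider "\<forall>v\<in>C. 0 < w \<bullet> (A *v v)" | "\<forall>v\<in>C. w \<bullet> (A *v v) < 0"
    using nz by (meson linorder_neqE_linordered_idom)
  then show ?thesis
  proof cases
    case 1
    then show ?thesis using im by (auto simp: C_def)
  next
    case 2
    have "proj_point (- (A *v v)) \<in> \<Omega>" if "v \<in> C" for v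
      using im[OF that] proj_point_scale[of "-1" "A *v v"] by simp
    then show ?thesis using 2 im by (auto simp: C_def neg)
  qed
qed

lemma Aut_lift:
  assumes "g \<in> Aut \<Omega>"
  obtains A B where "g = proj_map A" "\<And>x. A *v (B *v x) = x" "\<And>x. B *v (A *v x) = x"
    "\<And>v. v \<in> C \<Longrightarrow> A *v v \<in> C" "\<And>v. v \<in> C \<Longrightarrow> B *v v \<in> C"
proof -
  obtain A0 where A0: "invertible A0" "g = proj_map A0" and g: "g ` \<Omega> = \<Omega>"
    using assms unfolding Aut_def PGL_def lift_of_def by blast
  have "\<exists>A. invertible A \<and> g = proj_map A \<and> (\<forall>v\<in>C. A *v v \<in> C)"
  proof -
    have "invertible (- A0)"
      using invertible_mult_nonzero[OF A0(1)] unfolding invertible_left_inverse[of "- A0"] matrix_left_invertible_ker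
      by (auto simp: matrix_vector_mult_def vec_eq_iff sum_negf)
    moreover have "g = proj_map (- A0)" using A0(2) by (simp add: proj_map_uminus)
    moreover have "proj_map A0 ` \<Omega> = \<Omega>" using A0(2) g by simp
    note lift_sign[OF A0(1) this]
    ultimately show ?thesis using A0 by (elim disjE) blast+
  qed
  then obtain A where A: "invertible A" "g = proj_map A" and AC: "\<And>v. v \<in> C \<Longrightarrow> A *v v \<in> C" by blast
  obtain B where "A ** B = mat 1" "B ** A = mat 1" using A(1) unfolding invertible_def by blast
  then have AB: "A *v (B *v x) = x" and BA: "B *v (A *v x) = x" for x
    by (simp_all add: matrix_vector_mul_assoc)
  have "B *v v \<in> C" if v: "v \<in> C" for v
  proof -
    have v': "v \<noteq> 0" "proj_point v \<in> \<Omega>" "0 < w \<bullet> v" using v by (auto simp: C_def)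
    then obtain q where q: "q \<in> \<Omega>" "g q = proj_point v" using g by (metis imageE)
    define u where "u = coord w q"
    have u: "u \<in> C" "u \<noteq> 0" "proj_point u = q"
      using coord_C[OF q(1)] coord[OF domain_chart(2)[OF q(1)]] by (auto simp: u_def)
    have Au: "A *v u \<in> C" using AC u(1) by blast
    have "proj_point (A *v u) = proj_point v"
      using proj_map_proj_point[OF A(1) u(2)] u(3) q(2) A(2) by simp
    moreover have "A *v u \<noteq> 0" using Au by (simp add: C_def)
    \<comment> \<open>Surjectivity of \<open>g\<close> on the domain makes \<open>v\<close> a
      multiple of some \<open>A *v u\<close>; both have positive height, so the factor is positive
      and the inverse preserves \<open>C\<close>.\<close>
    ultimately obtain c where c: "A *v u = c *\<^sub>R v" using proj_point_eq_iff v'(1) by blast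
    have "0 < c * (w \<bullet> v)" using Au by (simp add: c C_def)
    then have "0 < c" using v'(3) by (simp add: zero_less_mult_iff)
    have "u = c *\<^sub>R (B *v v)" using BA[of u] by (simp add: c matrix_vector_mult_scaleR)
    then have "B *v v = (1 / c) *\<^sub>R u" using \<open>0 < c\<close> by simp
    then show ?thesis using C_scale[OF u(1), of "1 / c"] \<open>0 < c\<close> by simp
  qed
  then show ?thesis using that A(2) AB BA AC by blast
qed

lemma matrix_K:
  assumes "\<And>v. v \<in> C \<Longrightarrow> A *v v \<in> C" "v \<in> K"
  shows "A *v v \<in> K"
proof -
  have "(*v) A ` closure C \<subseteq> closure C"
    using assms(1) closure_subset[of C]
    by (intro image_closure_subset matrix_vector_mult_linear_continuous_on) auto
  then show ?thesis using assms(2) unfolding K_def by blast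
qed

text \<open>A lift preserving the cone permutes the two ends of the axis. If it swapped them or had equal
  eigenvalues there, it would fix a point of the axis and have translation length zero.\<close>

lemma rank_one_cone_axis:
  assumes "rank_one_isometry \<Omega> g"
  obtains a b A B \<alpha> \<beta> where "cone_axis C K w a b A B \<alpha> \<beta>" "g = proj_map A"
proof -
  obtain p q where Aut: "g \<in> Aut \<Omega>" and tl: "0 < translation_length \<Omega> g" and pq: "axis_ends \<Omega> g p q"
    and nht: "\<not> in_half_triangle \<Omega> p q"
    using assms unfolding rank_one_isometry_def by blast
  obtain V where fr: "p \<in> frontier \<Omega>" "q \<in> frontier \<Omega>" "p \<noteq> q" and V: "subspace V" "dim V = 2"
    "g ` proj_space V \<subseteq> proj_space V" "proj_space V \<inter> \<Omega> = open_seg \<Omega> p q"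
    using pq unfolding axis_ends_def by blast
  obtain A B where gA: "g = proj_map A" and AB: "\<And>x. A *v (B *v x) = x" and BA: "\<And>x. B *v (A *v x) = x"
    and AC: "\<And>v. v \<in> C \<Longrightarrow> A *v v \<in> C" and BC: "\<And>v. v \<in> C \<Longrightarrow> B *v v \<in> C"
    using Aut_lift[OF Aut] by blast
  have A_nz: "A *v x \<noteq> 0" if "x \<noteq> 0" for x using BA[of x] that by auto
  have inv_A: "invertible A"
    unfolding invertible_left_inverse matrix_left_invertible_ker using A_nz by blast
  have cl: "p \<in> closure \<Omega>" "q \<in> closure \<Omega>" using fr by (auto simp: frontier_def)
  define a b where "a = coord w p" and "b = coord w q"
  have a: "a \<in> K" "a \<notin> C" "w \<bullet> a = 1" "a \<noteq> 0" "a \<in> line p" "proj_point a = p"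
    and b: "b \<in> K" "b \<notin> C" "w \<bullet> b = 1" "b \<noteq> 0" "b \<in> line q" "proj_point b = q"
    using coord_frontier[OF fr(1)] coord_frontier[OF fr(2)] coord[OF domain_chart(1)[OF cl(1)]]
      coord[OF domain_chart(1)[OF cl(2)]] by (auto simp: a_def b_def)
  have ab: "a \<noteq> b" using a(6) b(6) fr(3) by auto
  have seg_C: "(1 - u) *\<^sub>R a + u *\<^sub>R b \<in> C" "(1 - u) *\<^sub>R a + u *\<^sub>R b \<in> V" if u: "0 < u" "u < 1" for u
  proof -
    let ?m = "(1 - u) *\<^sub>R a + u *\<^sub>R b"
    have "?m \<in> closed_segment a b" unfolding in_segment(1) using u by (intro exI[of _ u]) simp
    then have "?m \<in> coord w ` seg \<Omega> p q" using coord_seg[OF cl] by (simp add: a_def b_def)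
    then obtain r where r: "r \<in> seg \<Omega> p q" "?m = coord w r" by blast
    have "?m - a = u *\<^sub>R (b - a)" "?m - b = (1 - u) *\<^sub>R (a - b)" by (simp_all add: algebra_simps)
    then have "?m \<noteq> a" "?m \<noteq> b" using u ab by auto
    then have "r \<in> open_seg \<Omega> p q" using r by (auto simp: open_seg_def a_def b_def)
    then have rV: "r \<in> proj_space V" "r \<in> \<Omega>" using V(4) by auto
    show "?m \<in> C" unfolding r(2) by (rule coord_C[OF rV(2)])
    show "?m \<in> V" unfolding r(2) using rV(1) coord(1)[OF domain_chart(2)[OF rV(2)]] by (auto simp: proj_space_def)
  qed
  have comb_C: "s *\<^sub>R a + t *\<^sub>R b \<in> C" if "0 < s" "0 < t" for s t
    using combination_C[OF a(1) b(1) _ _ _ that, of "1/2" "1/2"] seg_C(1)[of "1/2"] by simp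
  \<comment> \<open>Only interior points of the axis are known to lie in \<open>V\<close>; two of
    them, at parameters 1/3 and 1/2, recover both ends.\<close>
  have "a = 3 *\<^sub>R ((1 - 1/3) *\<^sub>R a + (1/3) *\<^sub>R b) - 2 *\<^sub>R ((1 - 1/2) *\<^sub>R a + (1/2) *\<^sub>R b)"
    "b = 4 *\<^sub>R ((1 - 1/2) *\<^sub>R a + (1/2) *\<^sub>R b) - 3 *\<^sub>R ((1 - 1/3) *\<^sub>R a + (1/3) *\<^sub>R b)"
    by (simp_all add: vec_eq_iff)
  then have abV: "a \<in> V" "b \<in> V"
    using seg_C(2)[of "1/3"] seg_C(2)[of "1/2"] V(1)
    by (metis (no_types, lifting) subspace_diff subspace_scale divide_less_eq_1 less_numeral_extra(1) zero_less_divide_iff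
      zero_less_numeral one_less_numeral_iff semiring_norm(76,77))+
  have indep: "c *\<^sub>R b \<noteq> a" for c
  proof
    assume eq: "c *\<^sub>R b = a"
    then have "c * (w \<bullet> b) = w \<bullet> a" by (metis inner_scaleR_right)
    then show False using eq ab a(3) b(3) by simp
  qed
  have "independent {a, b}"
    using indep ab b(4) by (auto simp: independent_insert span_singleton)
  then have "V \<subseteq> span {a, b}"
    using card_ge_dim_independent[of "{a, b}" V] abV V(2) ab by simp
  \<comment> \<open>The part of \<open>K\<close> in \<open>V\<close> is the quadrant of
    \<open>a\<close> and \<open>b\<close>: with a negative coefficient, adding the reflected vector,
    which is in \<open>C\<close>, would put a multiple of one end into \<open>C\<close>.\<close>
  have VK: "\<exists>s t. 0 \<le> s \<and> 0 \<le> t \<and> v = s *\<^sub>R a + t *\<^sub>R b" if v: "v \<in> V" "v \<in> K" for v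
  proof -
    obtain s t where st: "v = s *\<^sub>R a + t *\<^sub>R b"
      using v(1) \<open>V \<subseteq> span {a, b}\<close> unfolding span_insert span_singleton by (auto simp: algebra_simps)
    have sum: "0 \<le> s + t" using w_nonneg[OF v(2)] by (simp add: st inner_add_right a(3) b(3))
    have "0 \<le> s"
    proof (rule ccontr)
      assume "\<not> 0 \<le> s"
      then have s: "s < 0" "0 < t" using sum by auto
      have "((- s) *\<^sub>R a + t *\<^sub>R b) + v \<in> C" using s by (intro C_K_add comb_C v(2)) auto
      moreover have "((- s) *\<^sub>R a + t *\<^sub>R b) + v = (2 * t) *\<^sub>R b" by (simp add: st vec_eq_iff)
      ultimately have "(2 * t) *\<^sub>R b \<in> C" by simp
      from C_scale[OF this, of "1 / (2 * t)"] show False using s b(2) by simp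
    qed
    moreover have "0 \<le> t"
    proof (rule ccontr)
      assume "\<not> 0 \<le> t"
      then have t: "t < 0" "0 < s" using sum by auto
      have "(s *\<^sub>R a + (- t) *\<^sub>R b) + v \<in> C" using t by (intro C_K_add comb_C v(2)) auto
      moreover have "(s *\<^sub>R a + (- t) *\<^sub>R b) + v = (2 * s) *\<^sub>R a" by (simp add: st vec_eq_iff)
      ultimately have "(2 * s) *\<^sub>R a \<in> C" by simp
      from C_scale[OF this, of "1 / (2 * s)"] show False using t a(2) by simp
    qed
    ultimately show ?thesis using st by blast
  qed
  \<comment> \<open>A boundary ray of the quadrant goes to a boundary ray, since \<open>B\<close>
    carries \<open>C\<close> back into itself.\<close>
  have im: "(\<exists>s>0. A *v x = s *\<^sub>R a) \<or> (\<exists>s>0. A *v x = s *\<^sub>R b)"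
    if x: "x \<in> V" "x \<in> K" "x \<notin> C" "x \<noteq> 0" for x
  proof -
    have "line (proj_point x) \<subseteq> V"
      unfolding line_proj_point[OF x(4)] using x(1) V(1) by (intro span_minimal) auto
    then have "g (proj_point x) \<in> proj_space V" using V(3) by (auto simp: proj_space_def)
    then have "proj_point (A *v x) \<in> proj_space V"
      unfolding gA proj_map_proj_point[OF inv_A x(4)] .
    then have "A *v x \<in> V"
      using line_proj_point[OF A_nz[OF x(4)]] by (auto simp: proj_space_def span_base)
    moreover have "A *v x \<in> K" using matrix_K[OF AC x(2)] .
    ultimately obtain s t where st: "0 \<le> s" "0 \<le> t" "A *v x = s *\<^sub>R a + t *\<^sub>R b" using VK by blast
    have "\<not> (0 < s \<and> 0 < t)"
    proof
      assume "0 < s \<and> 0 < t"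
      then have "A *v x \<in> C" using st(3) comb_C by simp
      then show False using BC[of "A *v x"] BA[of x] x(3) by simp
    qed
    then consider "s = 0" "t = 0" | "s = 0" "0 < t" | "0 < s" "t = 0" using st by fastforce
    then show ?thesis using st(3) A_nz[OF x(4)] by cases auto
  qed
  have no_fix: False if v: "v \<in> C" "A *v v = k *\<^sub>R v" for v k
  proof -
    have v': "v \<noteq> 0" "proj_point v \<in> \<Omega>" using v(1) by (auto simp: C_def)
    then have "k \<noteq> 0" using A_nz[OF v'(1)] v(2) by auto
    then have "g (proj_point v) = proj_point v"
      unfolding gA proj_map_proj_point[OF inv_A v'(1)] v(2) using proj_point_scale v'(1) by blast
    then show False using translation_length_le_0[OF _ v'(2), of g] tl Aut by (auto simp: Aut_def)
  qed
  \<comment> \<open>A point of the two segments off the frontier lifts to a nonnegative combination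
    in \<open>C\<close>; \<open>combination_C\<close> then changes both coefficients to 1.\<close>
  have half: "z + a \<in> C \<or> z + b \<in> C" if z: "z \<in> K" "z \<noteq> 0" for z
  proof (cases "z \<in> C")
    case True
    then show ?thesis using C_K_add[OF True a(1)] by blast
  next
    case False
    let ?\<zeta> = "proj_point z"
    have z\<zeta>: "?\<zeta> \<in> frontier \<Omega>" using frontier_proj_point z False by blast
    have wz: "0 < w \<bullet> z" using w_pos z by blast
    then have cz: "coord w ?\<zeta> = (1 / (w \<bullet> z)) *\<^sub>R z" using coord_proj_point[of w z] by simp
    have "\<not> seg \<Omega> p ?\<zeta> \<union> seg \<Omega> ?\<zeta> q \<subseteq> frontier \<Omega>"
      using nht z\<zeta> unfolding in_half_triangle_def by blast
    then obtain r where r: "r \<in> seg \<Omega> p ?\<zeta> \<or> r \<in> seg \<Omega> ?\<zeta> q" "r \<notin> frontier \<Omega>" by blast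
    then have "r \<in> \<Omega>" using open_domain by (auto simp: seg_eq frontier_def interior_open)
    then have rC: "coord w r \<in> C" by (rule coord_C)
    have "coord w r \<in> closed_segment z' x \<Longrightarrow> z' = (1 / (w \<bullet> z)) *\<^sub>R z \<Longrightarrow> x \<in> K \<Longrightarrow> z + x \<in> C" for x z'
    proof -
      assume *: "coord w r \<in> closed_segment z' x" "z' = (1 / (w \<bullet> z)) *\<^sub>R z" "x \<in> K"
      obtain u where u: "0 \<le> u" "u \<le> 1" "coord w r = (1 - u) *\<^sub>R z' + u *\<^sub>R x"
        using *(1) unfolding in_segment(1) by auto
      have "((1 - u) / (w \<bullet> z)) *\<^sub>R z + u *\<^sub>R x \<in> C" using rC u(3) by (simp add: *(2))
      from combination_C[OF z(1) *(3) _ u(1) this, of 1 1] show "z + x \<in> C"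
        using u(2) wz by simp
    qed
    then show ?thesis using r(1) a(1) b(1) by (auto simp: seg_eq cz a_def b_def closed_segment_commute)
  qed
  have axis: "cone_axis C K w x y A B \<alpha> \<beta>"
    if "x \<in> K" "y \<in> K" "x \<noteq> 0" "y \<noteq> 0" "x + y \<in> C" "\<And>z. z \<in> K \<Longrightarrow> z \<noteq> 0 \<Longrightarrow> z + x \<in> C \<or> z + y \<in> C"
      "A *v x = \<alpha> *\<^sub>R x" "A *v y = \<beta> *\<^sub>R y" "0 < \<beta>" "\<beta> < \<alpha>" for x y \<alpha> \<beta>
    by unfold_locales
      (use that open_C C_sub_K closed_K K_add K_scale w_pos AB BA matrix_K[OF AC] matrix_K[OF BC] in auto)
  have abC: "a + b \<in> C" "b + a \<in> C" using comb_C[of 1 1] by (simp_all add: add.commute)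
  consider (diag) s t where "0 < s" "0 < t" "A *v a = s *\<^sub>R a" "A *v b = t *\<^sub>R b"
    | (swap) s t where "0 < s" "0 < t" "A *v a = s *\<^sub>R b" "A *v b = t *\<^sub>R a"
    | (same) s t c where "0 < s" "0 < t" "A *v a = s *\<^sub>R c" "A *v b = t *\<^sub>R c"
    using im[OF abV(1) a(1,2,4)] im[OF abV(2) b(1,2,4)] by blast
  then show ?thesis
  proof cases
    case diag
    have "s \<noteq> t"
    proof
      assume "s = t"
      then have "A *v (a + b) = s *\<^sub>R (a + b)" using diag by (simp add: matrix_vector_right_distrib scaleR_add_right)
      then show False using no_fix abC(1) by blast
    qed
    then consider "t < s" | "s < t" by linarith
    then show ?thesis
    proof cases
      case 1
      have "cone_axis C K w a b A B s t" by (rule axis) (use a b half abC diag 1 in auto)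
      then show ?thesis using that gA by blast
    next
      case 2
      have "cone_axis C K w b a A B t s" by (rule axis) (use a b half abC diag 2 in auto)
      then show ?thesis using that gA by blast
    qed
  next
    case swap
    \<comment> \<open>The weights are chosen to produce an eigenvector, with eigenvalue
      \<open>sqrt (s * t)\<close>.\<close>
    have "sqrt t *\<^sub>R a + sqrt s *\<^sub>R b \<in> C" using swap by (intro comb_C) auto
    moreover have "A *v (sqrt t *\<^sub>R a + sqrt s *\<^sub>R b) = (sqrt s * sqrt t) *\<^sub>R (sqrt t *\<^sub>R a + sqrt s *\<^sub>R b)"
    proof -
      have sq: "sqrt s * sqrt t * sqrt t = sqrt s * t" "sqrt s * sqrt t * sqrt s = sqrt t * s"
        using swap(1,2) by (simp_all add: mult.assoc mult.left_commute[of "sqrt s"])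
      show ?thesis
        by (simp add: swap(3,4) sq matrix_vector_right_distrib matrix_vector_mult_scaleR scaleR_add_right add.commute)
    qed
    ultimately show ?thesis using no_fix by blast
  next
    case same
    have "t *\<^sub>R a = s *\<^sub>R b"
      using BA[of "t *\<^sub>R a"] BA[of "s *\<^sub>R b"] same by (simp add: matrix_vector_mult_scaleR mult.commute)
    then have "(1 / t) *\<^sub>R (t *\<^sub>R a) = (1 / t) *\<^sub>R (s *\<^sub>R b)" by (rule arg_cong)
    then show ?thesis using indep[of "s / t"] same(2) by simp
  qed
qed

text \<open>\<open>Q\<close> is lifted to the compact slice \<open>f + g = 1\<close>. The only point
  of the slice with \<open>f = 0\<close> is \<open>b\<close>, so removing the repelling point gives
  the positivity that uniform attraction asks for.\<close>

lemma north_south: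
  assumes "cone_axis_dual C K w a b A B \<alpha> \<beta> f g" "compact Q" "Q \<subseteq> closure \<Omega> - {proj_point b}"
  shows "uniform_limit Q (\<lambda>n. proj_map A ^^ n) (\<lambda>x. proj_point a) sequentially"
  unfolding uniform_limit_iff
proof (intro allI impI)
  interpret d: cone_axis_dual C K w a b A B \<alpha> \<beta> f g by (rule assms(1))
  fix e :: real assume "0 < e"
  have "isCont proj_point a"
    using continuous_on_proj_point d.a_nz continuous_on_eq_continuous_at[OF open_Compl[OF closed_singleton]] by blast
  then obtain \<delta> where \<delta>: "0 < \<delta>" "\<And>u. dist u a < \<delta> \<Longrightarrow> dist (proj_point u) (proj_point a) < e"
    using \<open>0 < e\<close> unfolding continuous_at_eps_delta by metis
  define T where "T = {x \<in> K. (f + g) \<bullet> x = 1}"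
  have T: "compact T" unfolding T_def by (rule compact_cone_slice[OF closed_K K_scale d.fg_pos])
  define Q' where "Q' = T \<inter> proj_point -` Q"
  have "T \<subseteq> - {0}" by (auto simp: T_def)
  then have "continuous_on T proj_point" using continuous_on_proj_point continuous_on_subset by blast
  then have "compact Q'"
    unfolding Q'_def using T continuous_closed_preimage[of T proj_point Q] compact_imp_closed[OF assms(2)]
    by (metis compact_Int_closed compact_imp_closed inf.idem inf_assoc)
  moreover have "Q' \<subseteq> K" by (auto simp: Q'_def T_def)
  moreover have "0 < f \<bullet> x" if x: "x \<in> Q'" for x
  proof (rule ccontr)
    assume "\<not> 0 < f \<bullet> x"
    moreover have xK: "x \<in> K" "(f + g) \<bullet> x = 1" "proj_point x \<in> Q" using x by (auto simp: Q'_def T_def)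
    ultimately have f0: "f \<bullet> x = 0" using d.f_nonneg[OF xK(1)] by simp
    from cone_axis_dual.g_zero_ray[OF d.dual_pair xK(1) f0] have "x = b"
      using xK(2) f0 by (simp add: inner_add_left)
    then show False using xK(3) assms(3) by auto
  qed
  ultimately have "\<forall>\<^sub>F n in sequentially. \<forall>x\<in>Q'. dist ((1 / ((f + g) \<bullet> (d.S ^^ n) x)) *\<^sub>R (d.S ^^ n) x) a < \<delta>"
    using d.uniform_dynamics \<delta>(1) by blast
  then show "\<forall>\<^sub>F n in sequentially. \<forall>p\<in>Q. dist ((proj_map A ^^ n) p) (proj_point a) < e"
  proof eventually_elim
    case (elim n)
    show ?case
    proof
      fix p assume p: "p \<in> Q"
      define v where "v = coord w p"
      have pcl: "p \<in> closure \<Omega>" using p assms(3) by blast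
      have v: "v \<in> K" "v \<noteq> 0" "proj_point v = p"
        using coord_K[OF pcl] coord[OF domain_chart(1)[OF pcl]] by (auto simp: v_def)
      define x where "x = (1 / ((f + g) \<bullet> v)) *\<^sub>R v"
      have fgv: "0 < (f + g) \<bullet> v" using d.fg_pos v by blast
      then have x: "x \<in> K" "x \<noteq> 0" "proj_point x = p" "(f + g) \<bullet> x = 1"
        using v by (auto simp: x_def proj_point_scale intro!: K_scale)
      have pow: "(d.S ^^ n) x \<noteq> 0 \<and> proj_point ((d.S ^^ n) x) = (proj_map A ^^ n) p" for n
      proof (induction n)
        case (Suc n)
        let ?y = "(d.S ^^ n) x"
        have y: "?y \<noteq> 0" "proj_point ?y = (proj_map A ^^ n) p" using Suc by auto
        have Ay: "A *v ?y \<noteq> 0" using invertible_mult_nonzero[OF d.invertible_A y(1)] .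
        have "\<alpha> \<noteq> 0" using d.ev by simp
        then have "(d.S ^^ Suc n) x \<noteq> 0" "proj_point ((d.S ^^ Suc n) x) = proj_point (A *v ?y)"
          using Ay by (simp_all add: d.S_def proj_point_scale)
        then show ?case using proj_map_proj_point[OF d.invertible_A y(1)] y(2) by simp
      qed (simp add: x)
      have "x \<in> Q'" using x p by (simp add: Q'_def T_def)
      with elim have "dist (proj_point ((1 / ((f + g) \<bullet> (d.S ^^ n) x)) *\<^sub>R (d.S ^^ n) x)) (proj_point a) < e"
        using \<delta>(2) by blast
      moreover have "0 < (f + g) \<bullet> (d.S ^^ n) x" using d.fg_pos d.S_K[OF x(1)] pow by blast
      ultimately show "dist ((proj_map A ^^ n) p) (proj_point a) < e"
        using pow[of n] by (simp add: proj_point_scale)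
    qed
  qed
qed

end

lemma inv_proj_map:
  assumes "\<And>x. A *v (B *v x) = x" "\<And>x. B *v (A *v x) = x"
  shows "inv (proj_map A) = proj_map B"
proof (rule inv_equality)
  have inv: "invertible A" "invertible B"
    unfolding invertible_left_inverse matrix_left_invertible_ker using assms by (metis matrix_vector_mult_0_right)+
  have l: "line (proj_map B (proj_map A p)) = line p" "line (proj_map A (proj_map B p)) = line p" for p
    by (simp_all add: line_proj_map inv image_image assms)
  then show "proj_map B (proj_map A p) = p" "proj_map A (proj_map B p) = p" for p
    by (simp_all add: line_inject)
qed

theorem corollary6p7:
  fixes \<Omega> :: "'n::finite proj set" and \<gamma> :: "'n proj \<Rightarrow> 'n proj"
  assumes "properly_convex \<Omega>"
    and "\<gamma> \<in> Aut \<Omega>"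
    and "rank_one_isometry \<Omega> \<gamma>"
  shows "(\<forall>K. compact K \<and> K \<subseteq> closure \<Omega> - {repelling_point \<gamma>} \<longrightarrow>
            uniform_limit K (\<lambda>n. \<gamma> ^^ n) (\<lambda>x. attracting_point \<gamma>) sequentially) \<and>
         (\<forall>K. compact K \<and> K \<subseteq> closure \<Omega> - {attracting_point \<gamma>} \<longrightarrow>
            uniform_limit K (\<lambda>n. inv \<gamma> ^^ n) (\<lambda>x. repelling_point \<gamma>) sequentially)"
proof -
  \<comment> \<open>The same choice as in \<open>aff\<close>, so that segments and distances refer
    to this chart.\<close>
  define w where "w = (SOME w. convex_chart \<Omega> w)"
  have "\<exists>w. convex_chart \<Omega> w" using assms(1) unfolding properly_convex_def by blast
  then have "convex_chart \<Omega> w" unfolding w_def by (rule someI_ex)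
  moreover have "aff \<Omega> = coord w" unfolding aff_def w_def ..
  ultimately interpret convex_domain \<Omega> w
    using assms(1) by unfold_locales (auto simp: properly_convex_def)
  obtain a b A B \<alpha> \<beta> where axis: "cone_axis C K w a b A B \<alpha> \<beta>" and \<gamma>: "\<gamma> = proj_map A"
    using rank_one_cone_axis[OF assms(3)] by blast
  obtain f g where pair: "cone_axis_dual C K w a b A B \<alpha> \<beta> f g"
    using cone_axis.obtain_dual[OF axis] by blast
  have ends: "attracting_point \<gamma> = proj_point a" "repelling_point \<gamma> = proj_point b"
    using cone_axis_dual.attracting_point_eq[OF pair \<gamma>] cone_axis_dual.repelling_point_eq[OF pair \<gamma>] .
  have inv: "inv \<gamma> = proj_map B"
    unfolding \<gamma> using cone_axis.AB[OF axis] cone_axis.BA[OF axis] by (rule inv_proj_map)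
  show ?thesis
  proof (intro conjI allI impI; elim conjE)
    fix Q assume "compact Q" "Q \<subseteq> closure \<Omega> - {repelling_point \<gamma>}"
    then show "uniform_limit Q (\<lambda>n. \<gamma> ^^ n) (\<lambda>x. attracting_point \<gamma>) sequentially"
      using north_south[OF pair] unfolding ends \<gamma>[symmetric] by simp
  next
    fix Q assume "compact Q" "Q \<subseteq> closure \<Omega> - {attracting_point \<gamma>}"
    then show "uniform_limit Q (\<lambda>n. inv \<gamma> ^^ n) (\<lambda>x. repelling_point \<gamma>) sequentially"
      \<comment> \<open>For the exchanged data the lift is \<open>B\<close>, the attracting end
        \<open>b\<close> and the excluded end \<open>a\<close>.\<close>
      using north_south[OF cone_axis_dual.dual_pair[OF pair]] unfolding ends inv by simp
  qed
qed

end
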